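(* Let $q\ge2$ be an integer. For a finite simple connected $(q+1)$-regular graph $\mathfrak{X}$ let $\mathrm{NV}^*_{\mathfrak{X}}$ denote the sub-oscillatory number variance of the random lattice orbit in the $(q+1)$-regular tree $\mathbb{T}_{q+1}$ associated to the fundamental group $\Gamma_{\mathfrak{X}}$ of $\mathfrak{X}$. (1) For the complete $(q+1)$-regular graph $\mathfrak{K}_{q+2}$ (on $q+2$ vertices), $$\liminf_{r \to +\infty} \frac{\mathrm{NV}_{\mathfrak{K}_{q+2}}^*(r)}{|B_r(o)|} = 0 .$$ (2) For the $(q+1)$-regular complete bipartite graph $\mathfrak{B}_{q+1}$ (with parts of $q+1$ vertices each), $$\liminf_{r \to +\infty} \frac{\mathrm{NV}_{\mathfrak{B}_{q+1}}^*(r)}{|B_r(o)|} > 0 .$$ (3) For the $3$-regular Petersen graph $\mathfrak{P}_3$ (so that $q=2$ and the tree is $\mathbb{T}_3$), $$\liminf_{r \to +\infty} \frac{\mathrm{NV}_{\mathfrak{P}_3}^*(r)}{|B_r(o)|} = 0 .$$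
   Context: Fix an integer $q\ge2$. $\mathbb{T}_{q+1}$ denotes (the vertex set of) the $(q+1)$-regular tree with graph metric $d$ and root $o$; $B_r(o)=\{x: d(x,o)\le r\}$ for integers $r\ge0$. A point process on $\mathbb{T}_{q+1}$ is a Borel probability measure $\mu$ on the space $\mathscr{M}_+(\mathbb{T}_{q+1})$ of positive locally finite measures $p$ on $\mathbb{T}_{q+1}$ (identified with functions $p:\mathbb{T}_{q+1}\to\mathbb{R}_{\ge0}$, topology of pointwise convergence). It is invariant if it is invariant under the push-forward action of $\operatorname{Aut}(\mathbb{T}_{q+1})$, and locally square-integrable if $\int p(\{x\})^2\,d\mu(p)<\infty$ for all vertices $x$. For finitely supported $f:\mathbb{T}_{q+1}\to\mathbb{C}$ put $\mathbb{S}f(p)=\sum_x p(\{x\})f(x)$. For $\lambda\in\mathbb{C}$, $\omega_\lambda$ is the unique function on $\mathbb{T}_{q+1}$ that depends only on $d(x,o)$, has $\omega_\lambda(o)=1$, and satisfies $\sum_{y\sim x}\omega_\lambda(y)=2\sqrt q\cos(\lambda\log q)\,\omega_\lambda(x)$ for all $x$ (the spherical function). For finitely supported radial $f$ (i.e. depending only on $d(x,o)$) set $\hat f(\lambda)=\sum_x f(x)\omega_\lambda(x)$. Let $\Lambda_q=i[0,\tfrac12]\cup(0,\tfrac{\pi}{\log q})\cup(\tfrac{\pi}{\log q}+i[0,\tfrac12])\subset\mathbb{C}$ and $\Lambda_q^*=\Lambda_q\setminus\{\tfrac i2,\tfrac{\pi}{\log q}+\tfrac i2\}$. The diffraction measure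 of an invariant locally square-integrable point process $\mu$ is the unique positive finite Borel measure $\sigma_\mu$ on $\Lambda_q$ such that $\int \mathbb{S}f_1\,\overline{\mathbb{S}f_2}\,d\mu=\int_{\Lambda_q}\hat f_1(\lambda)\overline{\hat f_2(\lambda)}\,d\sigma_\mu(\lambda)$ for all finitely supported radial $f_1,f_2$ (its existence and uniqueness are taken as known). The sub-oscillatory number variance is, for integers $r\ge0$, $$\mathrm{NV}^*_\mu(r)=\int_{\Lambda_q^*}|\hat\chi_{B_r(o)}(\lambda)|^2d\sigma_\mu(\lambda)=q^r\int_{\Lambda_q^*}\frac{\big(\sin(\lambda(r+1)\log q)+q^{-1/2}\sin(\lambda r\log q)\big)^2}{\sin^2(\lambda\log q)}\,d\sigma_\mu(\lambda),$$ where $\chi_{B_r(o)}$ is the indicator function of $B_r(o)$ and the integrand is extended by continuity to $\lambda\in\{0,\tfrac{\pi}{\log q}\}$. For a finite simple connected $(q+1)$-regular graph $\mathfrak{X}$ with a base vertex $u$, the universal cover is $\mathbb{T}_{q+1}$ (with $o$ lying over $u$), and $\Gamma_{\mathfrak{X}}<G_q=\operatorname{Aut}(\mathbb{T}_{q+1})$ is the group of deck transformations, isomorphic to the fundamental group of $\mathfrak{X}$; it acts freely on the vertices, is a cocompact lattice in $G_q$, and is well defined up to conjugation by the stabilizer of $o$. The random lattice orbit $\mu_{\mathfrak{X}}$ is the law of the random counting measure $\sum_{x\in g^{-1}\Gamma_{\mathfrak{X}}.o}\delta_x$, where $\Gamma_{\mathfrak{X}}g$ is distributed according to the $G_q$-invariant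 probability measure on $\Gamma_{\mathfrak{X}}\backslash G_q$; it is an invariant locally square-integrable point process, and $\mathrm{NV}^*_{\mathfrak{X}}:=\mathrm{NV}^*_{\mu_{\mathfrak{X}}}$. *)

theory Defs
  imports "HOL-Analysis.Analysis" "HOL-Algebra.Bij" "HOL-Algebra.Coset"
begin

text \<open>
  A graph is given by its adjacency relation.  Finite graphs carry an explicit vertex set; the
  vertices of the regular tree are all the elements of a type, so that configurations of points
  are total functions and the library topology on functions is the topology of pointwise
  convergence.
\<close>

subsection \<open>The regular tree and its automorphism group\<close>

definition graph_cycle :: "('v \<Rightarrow> 'v \<Rightarrow> bool) \<Rightarrow> 'v list \<Rightarrow> bool" where
  "graph_cycle T xs \<longleftrightarrow>
     3 \<le> length xs \<and> distinct xs \<and> successively T xs \<and> T (last xs) (hd xs)"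

definition regular_tree :: "nat \<Rightarrow> ('v \<Rightarrow> 'v \<Rightarrow> bool) \<Rightarrow> bool" where
  "regular_tree d T \<longleftrightarrow>
     symp T \<and> irreflp T \<and>
     (\<forall>x. finite {y. T x y} \<and> card {y. T x y} = d) \<and>
     (\<forall>x y. T\<^sup>*\<^sup>* x y) \<and>
     (\<nexists>xs. graph_cycle T xs)"

definition graph_dist :: "('v \<Rightarrow> 'v \<Rightarrow> bool) \<Rightarrow> 'v \<Rightarrow> 'v \<Rightarrow> nat" where
  "graph_dist T x y = (LEAST n. (T ^^ n) x y)"

definition graph_ball :: "('v \<Rightarrow> 'v \<Rightarrow> bool) \<Rightarrow> 'v \<Rightarrow> nat \<Rightarrow> 'v set" where
  "graph_ball T x\<^sub>0 r = {x. graph_dist T x x\<^sub>0 \<le> r}"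

definition graph_aut :: "('v \<Rightarrow> 'v \<Rightarrow> bool) \<Rightarrow> ('v \<Rightarrow> 'v) set" where
  "graph_aut T = {g. bij g \<and> (\<forall>x y. T (g x) (g y) \<longleftrightarrow> T x y)}"

definition aut_group :: "('v \<Rightarrow> 'v \<Rightarrow> bool) \<Rightarrow> ('v \<Rightarrow> 'v) monoid" where
  "aut_group T = (BijGroup UNIV)\<lparr>carrier := graph_aut T\<rparr>"

definition aut_topology :: "('v \<Rightarrow> 'v \<Rightarrow> bool) \<Rightarrow> ('v \<Rightarrow> 'v) topology" where
  "aut_topology T =
     subtopology (product_topology (\<lambda>_. discrete_topology UNIV) UNIV) (graph_aut T)"

subsection \<open>Universal covers and deck transformations\<close>

definition covering_map ::
  "('v \<Rightarrow> 'v \<Rightarrow> bool) \<Rightarrow> 'w set \<Rightarrow> ('w \<Rightarrow> 'w \<Rightarrow> bool) \<Rightarrow> ('v \<Rightarrow> 'w) \<Rightarrow> bool" where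
  "covering_map T V E \<pi> \<longleftrightarrow>
     \<pi> ` UNIV = V \<and> (\<forall>x. bij_betw \<pi> {y. T x y} {w. E (\<pi> x) w})"

definition deck_group :: "('v \<Rightarrow> 'v \<Rightarrow> bool) \<Rightarrow> ('v \<Rightarrow> 'w) \<Rightarrow> ('v \<Rightarrow> 'v) set" where
  "deck_group T \<pi> = {g \<in> graph_aut T. \<forall>x. \<pi> (g x) = \<pi> x}"

text \<open>
  The space of right cosets \<open>\<Gamma>g\<close> with the Borel sets of the quotient topology: a set of cosets is
  open iff its union is open in the automorphism group.
\<close>

definition coset_space ::
  "('v \<Rightarrow> 'v \<Rightarrow> bool) \<Rightarrow> ('v \<Rightarrow> 'v) set \<Rightarrow> ('v \<Rightarrow> 'v) set measure" where
  "coset_space T \<Gamma> =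
     sigma (rcosets\<^bsub>aut_group T\<^esub> \<Gamma>)
       {U. U \<subseteq> rcosets\<^bsub>aut_group T\<^esub> \<Gamma> \<and> openin (aut_topology T) (\<Union>U)}"

definition invariant_coset_probability ::
  "('v \<Rightarrow> 'v \<Rightarrow> bool) \<Rightarrow> ('v \<Rightarrow> 'v) set \<Rightarrow> ('v \<Rightarrow> 'v) set measure \<Rightarrow> bool" where
  "invariant_coset_probability T \<Gamma> m \<longleftrightarrow>
     sets m = sets (coset_space T \<Gamma>) \<and> emeasure m (space m) = 1 \<and>
     (\<forall>g\<in>graph_aut T. distr m m (\<lambda>C. C #>\<^bsub>aut_group T\<^esub> g) = m)"

subsection \<open>Point processes\<close>

definition configurations :: "('v \<Rightarrow> real) measure" where
  "configurations = restrict_space borel {p. \<forall>x. 0 \<le> p x}"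

text \<open>
  For a coset \<open>C = \<Gamma>g\<close> the inverses of its elements form \<open>g\<inverse>\<Gamma>\<close>, so the image of \<open>C\<close> below is the
  set \<open>g\<inverse>\<Gamma>.x\<^sub>0\<close>, and its indicator function is the counting measure on that set.
\<close>

definition random_lattice_orbit ::
  "('v \<Rightarrow> 'v \<Rightarrow> bool) \<Rightarrow> 'v \<Rightarrow> ('v \<Rightarrow> 'v) set measure \<Rightarrow> ('v \<Rightarrow> real) measure" where
  "random_lattice_orbit T x\<^sub>0 m =
     distr m configurations (\<lambda>C. indicator ((\<lambda>h. (inv\<^bsub>aut_group T\<^esub> h) x\<^sub>0) ` C))"

definition linear_statistic :: "('v \<Rightarrow> complex) \<Rightarrow> ('v \<Rightarrow> real) \<Rightarrow> complex" where
  "linear_statistic f p = (\<Sum>x | f x \<noteq> 0. of_real (p x) * f x)"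

subsection \<open>Spherical functions and diffraction\<close>

definition radial :: "('v \<Rightarrow> 'v \<Rightarrow> bool) \<Rightarrow> 'v \<Rightarrow> ('v \<Rightarrow> complex) \<Rightarrow> bool" where
  "radial T x\<^sub>0 f \<longleftrightarrow> (\<forall>x y. graph_dist T x x\<^sub>0 = graph_dist T y x\<^sub>0 \<longrightarrow> f x = f y)"

definition spherical_function ::
  "nat \<Rightarrow> ('v \<Rightarrow> 'v \<Rightarrow> bool) \<Rightarrow> 'v \<Rightarrow> complex \<Rightarrow> 'v \<Rightarrow> complex" where
  "spherical_function q T x\<^sub>0 l =
     (THE \<omega>. radial T x\<^sub>0 \<omega> \<and> \<omega> x\<^sub>0 = 1 \<and>
        (\<forall>x. (\<Sum>y | T x y. \<omega> y) =
          2 * of_real (sqrt (real q)) * cos (l * of_real (ln (real q))) * \<omega> x))"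

definition spherical_transform ::
  "nat \<Rightarrow> ('v \<Rightarrow> 'v \<Rightarrow> bool) \<Rightarrow> 'v \<Rightarrow> ('v \<Rightarrow> complex) \<Rightarrow> complex \<Rightarrow> complex" where
  "spherical_transform q T x\<^sub>0 f l = (\<Sum>x | f x \<noteq> 0. f x * spherical_function q T x\<^sub>0 l x)"

definition spectral_set :: "nat \<Rightarrow> complex set" where
  "spectral_set q =
     (\<lambda>t. \<i> * of_real t) ` {0..1/2} \<union>
     of_real ` {0<..<pi / ln (real q)} \<union>
     (\<lambda>t. of_real (pi / ln (real q)) + \<i> * of_real t) ` {0..1/2}"

definition spectral_set_star :: "nat \<Rightarrow> complex set" where
  "spectral_set_star q = spectral_set q - {\<i> / 2, of_real (pi / ln (real q)) + \<i> / 2}"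

definition diffraction_measure ::
  "nat \<Rightarrow> ('v \<Rightarrow> 'v \<Rightarrow> bool) \<Rightarrow> 'v \<Rightarrow> ('v \<Rightarrow> real) measure \<Rightarrow> complex measure" where
  "diffraction_measure q T x\<^sub>0 \<mu> =
     (THE \<sigma>. sets \<sigma> = sets (restrict_space borel (spectral_set q)) \<and> finite_measure \<sigma> \<and>
        (\<forall>f\<^sub>1 f\<^sub>2. finite {x. f\<^sub>1 x \<noteq> 0} \<and> radial T x\<^sub>0 f\<^sub>1 \<and> finite {x. f\<^sub>2 x \<noteq> 0} \<and> radial T x\<^sub>0 f\<^sub>2 \<longrightarrow>
           (\<integral>p. linear_statistic f\<^sub>1 p * cnj (linear_statistic f\<^sub>2 p) \<partial>\<mu>) =
           (\<integral>l. spherical_transform q T x\<^sub>0 f\<^sub>1 l * cnj (spherical_transform q T x\<^sub>0 f\<^sub>2 l) \<partial>\<sigma>)))"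

definition sub_osc_number_variance ::
  "nat \<Rightarrow> ('v \<Rightarrow> 'v \<Rightarrow> bool) \<Rightarrow> 'v \<Rightarrow> ('v \<Rightarrow> real) measure \<Rightarrow> nat \<Rightarrow> real" where
  "sub_osc_number_variance q T x\<^sub>0 \<mu> r =
     (LINT l : spectral_set_star q | diffraction_measure q T x\<^sub>0 \<mu>.
        (cmod (spherical_transform q T x\<^sub>0 (indicator (graph_ball T x\<^sub>0 r)) l))\<^sup>2)"

subsection \<open>The three families of finite graphs\<close>

definition complete_verts :: "nat \<Rightarrow> nat set" where
  "complete_verts n = {..<n}"

definition complete_adj :: "nat \<Rightarrow> nat \<Rightarrow> nat \<Rightarrow> bool" where
  "complete_adj n v w \<longleftrightarrow> v \<in> complete_verts n \<and> w \<in> complete_verts n \<and> v \<noteq> w"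

definition bipartite_verts :: "nat \<Rightarrow> (nat + nat) set" where
  "bipartite_verts n = {..<n} <+> {..<n}"

definition bipartite_adj :: "nat \<Rightarrow> nat + nat \<Rightarrow> nat + nat \<Rightarrow> bool" where
  "bipartite_adj n v w \<longleftrightarrow> v \<in> bipartite_verts n \<and> w \<in> bipartite_verts n \<and> isl v \<noteq> isl w"

text \<open>The Petersen graph as the Kneser graph of the two-element subsets of a five-element set.\<close>

definition petersen_verts :: "nat set set" where
  "petersen_verts = {A. A \<subseteq> {..<5} \<and> card A = 2}"

definition petersen_adj :: "nat set \<Rightarrow> nat set \<Rightarrow> bool" where
  "petersen_adj A B \<longleftrightarrow> A \<in> petersen_verts \<and> B \<in> petersen_verts \<and> A \<inter> B = {}"

end

(*
  Write the indicator of the base vertex u of the finite graph as a sum of eigenfunctions e_theta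
  of its adjacency operator.  Lifted to the tree, e_theta is an eigenfunction there, so its sum
  over a sphere is a polynomial in theta times its value at the centre; hence a linear statistic
  with radial f is the sum of f^(theta) e_theta evaluated at one random vertex of the finite graph.
  That vertex is uniformly distributed (its law is harmonic), and eigenfunctions with different
  theta are orthogonal, so the diffraction measure has an atom of mass |e_theta|^2 / |V| at the
  point of the spectral set belonging to theta, and nothing else.

  The sub-oscillatory number variance is therefore a finite sum over the eigenvalues with
  |theta| < 2 sqrt q.  For the complete graph (theta = -1, k = 1) and the Petersen graph
  (theta = 1, -2, k = 2) the transform of the indicator of the ball of radius k vanishes at all of
  these; the transform at radius k + n is then a multiple of q^(n/2) sin(n phi), and simultaneous
  Dirichlet approximation makes all the sines small at once.  For the bipartite graph the only
  such eigenvalue is 0, where the transform has absolute value about q^(r/2) for every r.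
*)
theory Submission
  imports Defs
begin

subsection \<open>Distances and spheres in the tree\<close>

text \<open>The complete graph and the Petersen graph are Moore graphs: a tree ball of radius
  \<open>k\<close> maps bijectively onto the vertices, as 1 + (q + 1) = q + 2 and 1 + 3 + 6 = 10. A
  nonconstant eigenfunction sums to zero over all vertices, which is why the ball transform vanishes
  at every eigenvalue other than q + 1. Ball sums obey a three-term recurrence, so one zero makes
  all later values a pure sine sequence; the phases need not be rational multiples of pi, hence the
  Diophantine approximation.

  The spherical function and the diffraction measure are definite descriptions, so an explicit
  candidate settles nothing until uniqueness is shown. For the measure this takes radial test
  functions whose transforms vanish at prescribed eigenvalues: one of them confines any candidate to
  the atoms, others weigh each atom.

  Passing from cosets to the finite graph needs automorphisms twice, for transitivity on the
  vertices of the tree and for transitivity of the deck group on fibres. Both come from one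
  extension construction.\<close>

locale tree =
  fixes q :: nat and T :: "'v \<Rightarrow> 'v \<Rightarrow> bool"
  assumes q2: "2 \<le> q" and tree: "regular_tree (q + 1) T"
begin

lemma sym: "T x y \<Longrightarrow> T y x"
  using tree by (auto simp: regular_tree_def symp_def)

lemma irrefl: "\<not> T x x"
  using tree by (auto simp: regular_tree_def irreflp_def)

lemma finite_nbrs [simp]: "finite {y. T x y}"
  using tree by (auto simp: regular_tree_def)

lemma card_nbrs: "card {y. T x y} = q + 1"
  using tree by (auto simp: regular_tree_def)

lemma connected: "T\<^sup>*\<^sup>* x y"
  using tree by (auto simp: regular_tree_def)

lemma no_cycle: "\<not> graph_cycle T xs"
  using tree by (auto simp: regular_tree_def)

lemma connected_induct:
  assumes "P x" "\<And>y z. P y \<Longrightarrow> T y z \<Longrightarrow> P z"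
  shows "P y"
  using connected[of x y] by (induction rule: rtranclp_induct) (auto intro: assms)

abbreviation dist where "dist \<equiv> graph_dist T"

lemma dist_walk: "(T ^^ dist x y) x y"
proof -
  have "\<exists>n. (T ^^ n) x y" using connected[of x y] by (simp add: rtranclp_power)
  then show ?thesis unfolding graph_dist_def by (rule LeastI_ex)
qed

lemma dist_le: "(T ^^ n) x y \<Longrightarrow> dist x y \<le> n"
  unfolding graph_dist_def by (rule Least_le)

lemma dist_refl [simp]: "dist x x = 0"
  using dist_le[of 0 x x] by simp

lemma dist_eq_0 [simp]: "dist x y = 0 \<longleftrightarrow> x = y"
proof
  assume "dist x y = 0" then show "x = y" using dist_walk[of x y] by simp
qed simp

lemma dist_nbr_le: "T y z \<Longrightarrow> dist z x \<le> Suc (dist y x)"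
  by (rule dist_le[OF relpowp_Suc_I2[OF sym dist_walk]])

lemma parent_exists:
  assumes "dist y x = Suc n"
  shows "\<exists>z. T y z \<and> dist z x = n"
proof -
  have "(T ^^ Suc n) y x" using dist_walk[of y x] assms by simp
  then obtain z where z: "T y z" "(T ^^ n) z x" using relpowp_Suc_D2 by metis
  then have "dist z x \<le> n" by (auto intro: dist_le)
  moreover have "Suc n \<le> Suc (dist z x)" using dist_nbr_le[OF sym[OF z(1)], of x] assms by simp
  ultimately show ?thesis using z by auto
qed

text \<open>The paths from \<open>a\<close> and \<open>b\<close> towards \<open>x\<close> are
  followed in parallel until they meet. An edge between \<open>a\<close> and \<open>b\<close>, or a
  common neighbour outside the ball, would close the result to a cycle, so this lemma serves both
  \<open>dist_nbr_neq\<close> and \<open>parent_unique\<close>. Three vertices is the length that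
  \<open>graph_cycle\<close> demands.\<close>

lemma path_through_ball:
  assumes "dist a x = n" "dist b x = n" "a \<noteq> b"
  shows "\<exists>xs. 3 \<le> length xs \<and> distinct xs \<and> successively T xs \<and> hd xs = a \<and> last xs = b \<and>
              (\<forall>y\<in>set xs. dist y x \<le> n)"
  using assms
proof (induction n arbitrary: a b)
  case 0 then show ?case by simp
next
  case (Suc n)
  obtain a' where a': "T a a'" "dist a' x = n" using parent_exists Suc.prems by blast
  obtain b' where b': "T b b'" "dist b' x = n" using parent_exists Suc.prems by blast
  show ?case
  proof (cases "a' = b'")
    case True
    have "a \<noteq> a'" "b \<noteq> a'" using a' b' irrefl True by blast+
    then show ?thesis using a' b' True Suc.prems
      by (intro exI[of _ "[a, a', b]"]) (auto intro: sym)
  next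
    case False
    with Suc.IH[OF a'(2) b'(2)] obtain xs where xs: "3 \<le> length xs" "distinct xs"
      "successively T xs" "hd xs = a'" "last xs = b'" "\<forall>y\<in>set xs. dist y x \<le> n" by blast
    have "xs \<noteq> []" using xs(1) by auto
    have "a \<notin> set xs" "b \<notin> set xs" using xs(6) Suc.prems by force+
    moreover have "successively T (a # xs @ [b])"
      using xs a' b' \<open>xs \<noteq> []\<close> by (auto simp: successively_append_iff successively_Cons intro: sym)
    ultimately show ?thesis using xs Suc.prems \<open>xs \<noteq> []\<close>
      by (intro exI[of _ "a # xs @ [b]"]) force
  qed
qed

lemma dist_nbr_neq: assumes "T a b" shows "dist a x \<noteq> dist b x"
proof
  assume eq: "dist a x = dist b x"
  have "a \<noteq> b" using assms irrefl by blast
  with path_through_ball[OF eq refl] obtain xs where "3 \<le> length xs" "distinct xs"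
    "successively T xs" "hd xs = a" "last xs = b" by blast
  then have "graph_cycle T xs" using assms by (auto simp: graph_cycle_def intro: sym)
  then show False using no_cycle by blast
qed

lemma parent_unique:
  assumes "T y a" "T y b" "dist a x = n" "dist b x = n" "dist y x = Suc n"
  shows "a = b"
proof (rule ccontr)
  assume "a \<noteq> b"
  with path_through_ball[OF assms(3,4)] obtain xs where xs: "3 \<le> length xs" "distinct xs"
    "successively T xs" "hd xs = a" "last xs = b" "\<forall>y\<in>set xs. dist y x \<le> n" by blast
  moreover have "y \<notin> set xs" using xs(6) assms(5) by force
  ultimately have "graph_cycle T (y # xs)"
    using assms by (cases xs) (auto simp: graph_cycle_def intro: sym)
  then show False using no_cycle by blast
qed

lemma dist_nbr_cases:
  assumes "T y z"
  shows "dist z x = Suc (dist y x) \<or> dist y x = Suc (dist z x)"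
  using dist_nbr_le[OF assms, of x] dist_nbr_le[OF sym[OF assms], of x] dist_nbr_neq[OF assms, of x]
  by linarith

lemma parent_ex1: "y \<noteq> x \<Longrightarrow> \<exists>!z. T y z \<and> dist y x = Suc (dist z x)"
proof -
  assume "y \<noteq> x"
  then obtain n where n: "dist y x = Suc n" by (metis dist_eq_0 not0_implies_Suc)
  then show ?thesis using parent_exists[OF n] parent_unique[of y _ _ x n] by fastforce
qed

section \<open>Spheres, parents and children\<close>

definition sphere where "sphere x n = {y. dist y x = n}"

lemma mem_sphere [simp]: "y \<in> sphere x n \<longleftrightarrow> dist y x = n"
  by (simp add: sphere_def)

lemma finite_sphere [simp]: "finite (sphere x n)"
proof (induction n)
  case (Suc n)
  have "sphere x (Suc n) \<subseteq> (\<Union>z\<in>sphere x n. {y. T z y})"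
    using parent_exists sym by (fastforce simp: sphere_def)
  then show ?case using Suc by (meson finite_UN_I finite_nbrs finite_subset)
qed (simp add: sphere_def)

lemma graph_ball_eq: "graph_ball T x r = (\<Union>n\<le>r. sphere x n)"
  by (auto simp: graph_ball_def)

lemma finite_ball [simp]: "finite (graph_ball T x r)"
  by (simp add: graph_ball_eq)

definition children where "children x z = {y. T z y \<and> dist y x = Suc (dist z x)}"

lemma finite_children [simp]: "finite (children x z)"
  by (rule finite_subset[OF _ finite_nbrs[of z]]) (auto simp: children_def)

lemma nbrs_root: "{y. T x y} = children x x"
  using dist_nbr_cases[of x _ x] by (fastforce simp: children_def)

definition parent where "parent x y = (if y = x then x else THE z. T y z \<and> dist y x = Suc (dist z x))"

lemma parent: assumes "y \<noteq> x" shows "T y (parent x y)" "dist y x = Suc (dist (parent x y) x)"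
  using theI'[OF parent_ex1[OF assms]] assms by (auto simp: parent_def)

lemma parentI: "T y z \<Longrightarrow> dist y x = Suc (dist z x) \<Longrightarrow> parent x y = z"
  using parent_ex1[of y x] parent[of y x] by (metis dist_refl nat.distinct(1))

lemma parent_root [simp]: "parent x x = x"
  by (simp add: parent_def)

lemma nbrs_nonroot:
  assumes "z \<noteq> x"
  shows "{y. T z y} = insert (parent x z) (children x z)" "parent x z \<notin> children x z"
proof -
  show "{y. T z y} = insert (parent x z) (children x z)"
  proof (intro equalityI subsetI)
    fix y assume "y \<in> {y. T z y}"
    then have "T z y" by simp
    from dist_nbr_cases[OF this, of x] show "y \<in> insert (parent x z) (children x z)"
      using \<open>T z y\<close> parentI[of z y x] by (auto simp: children_def)
  qed (use parent(1)[OF assms] in \<open>auto simp: children_def\<close>)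
  show "parent x z \<notin> children x z" using parent(2)[OF assms] by (auto simp: children_def)
qed

lemma card_children: "card (children x z) = (if z = x then q + 1 else q)"
  using nbrs_root[of x] nbrs_nonroot[of z x] card_nbrs[of z] by auto

lemma children_iff: "y \<in> children x z \<longleftrightarrow> y \<noteq> x \<and> parent x y = z"
  using parent[of y x] parentI[of y z x] by (auto simp: children_def intro: sym)

lemma sphere_0 [simp]: "sphere x 0 = {x}"
  by (auto simp: sphere_def)

lemma sum_children:
  "(\<Sum>z\<in>sphere x n. \<Sum>y\<in>children x z. f y) = (\<Sum>y\<in>sphere x (Suc n). f y)"
proof -
  have "(\<Sum>z\<in>sphere x n. \<Sum>y\<in>children x z. f y) = (\<Sum>y\<in>(\<Union>z\<in>sphere x n. children x z). f y)"
    by (rule sum.UNION_disjoint[symmetric]) (auto simp: children_iff)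
  also have "(\<Union>z\<in>sphere x n. children x z) = sphere x (Suc n)"
  proof (intro equalityI subsetI)
    fix y assume "y \<in> sphere x (Suc n)"
    then have "y \<noteq> x" by auto
    then show "y \<in> (\<Union>z\<in>sphere x n. children x z)"
      using parent(2)[of y x] \<open>y \<in> sphere x (Suc n)\<close> by (simp add: children_iff)
  qed (auto simp: children_def)
  finally show ?thesis .
qed

text \<open>These polynomials express the sphere operators of the tree through the adjacency
  operator. The coefficient q + 1 occurs once because only the centre has q + 1 children. The ring
  is left open: integers serve to count spheres, real and complex numbers to evaluate at
  eigenvalues.\<close>

fun sph :: "nat \<Rightarrow> 'a::comm_ring_1 \<Rightarrow> 'a" where
  "sph 0 t = 1"
| "sph (Suc 0) t = t"
| "sph (Suc (Suc n)) t = t * sph (Suc n) t - (if n = 0 then of_nat q + 1 else of_nat q) * sph n t"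

text \<open>The eigenvalue equation is summed over the sphere of radius n + 1. Each neighbour sum
  splits into parent and children; the children fill the next sphere, and a vertex at radius n is
  counted as a parent once for each of its children.\<close>

lemma sum_sphere_eigen:
  fixes f :: "'v \<Rightarrow> 'a::comm_ring_1"
  assumes eig: "\<And>z. (\<Sum>y | T z y. f y) = t * f z"
  shows "(\<Sum>y\<in>sphere x n. f y) = sph n t * f x"
proof (induction n rule: induct_nat_012)
  case 0 then show ?case by simp
next
  case 1
  have "(\<Sum>y\<in>sphere x (Suc 0). f y) = (\<Sum>y\<in>children x x. f y)"
    using sum_children[of f x 0] by simp
  then show ?case using eig[of x] by (simp add: nbrs_root)
next
  case (ge2 n)
  have nz: "z \<noteq> x" if "z \<in> sphere x (Suc n)" for z using that by auto
  have "t * (\<Sum>z\<in>sphere x (Suc n). f z) = (\<Sum>z\<in>sphere x (Suc n). \<Sum>y | T z y. f y)"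
    by (simp add: eig sum_distrib_left)
  also have "\<dots> = (\<Sum>z\<in>sphere x (Suc n). f (parent x z) + (\<Sum>y\<in>children x z. f y))"
    by (intro sum.cong refl) (use nz nbrs_nonroot[of _ x] in simp)
  also have "\<dots> = (\<Sum>z\<in>sphere x (Suc n). f (parent x z)) + (\<Sum>y\<in>sphere x (Suc (Suc n)). f y)"
    by (simp add: sum.distrib sum_children)
  also have "(\<Sum>z\<in>sphere x (Suc n). f (parent x z)) =
      (\<Sum>z\<in>sphere x n. \<Sum>y\<in>children x z. f (parent x y))"
    by (rule sum_children[symmetric])
  also have "\<dots> = (\<Sum>z\<in>sphere x n. of_nat (if n = 0 then q + 1 else q) * f z)"
  proof (intro sum.cong refl)
    fix z assume "z \<in> sphere x n"
    then have "(z = x) = (n = 0)" by auto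
    have "(\<Sum>y\<in>children x z. f (parent x y)) = (\<Sum>y\<in>children x z. f z)"
      by (intro sum.cong refl) (simp add: children_iff)
    then show "(\<Sum>y\<in>children x z. f (parent x y)) = of_nat (if n = 0 then q + 1 else q) * f z"
      using \<open>(z = x) = (n = 0)\<close> by (simp add: card_children)
  qed
  finally have "(\<Sum>y\<in>sphere x (Suc (Suc n)). f y) =
     t * (\<Sum>z\<in>sphere x (Suc n). f z) - of_nat (if n = 0 then q + 1 else q) * (\<Sum>z\<in>sphere x n. f z)"
    by (simp add: sum_distrib_left)
  then show ?case using ge2 by (cases "n = 0") (simp_all add: algebra_simps)
qed

lemma card_sphere_eq: "of_nat (card (sphere x n)) = sph n (of_nat (q + 1))"
  using sum_sphere_eigen[of "\<lambda>_. 1" "of_nat (q + 1)" x n] by (simp add: card_nbrs)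

lemma card_sphere: "card (sphere x 0) = 1" "card (sphere x (Suc n)) = (q + 1) * q ^ n"
proof -
  show "card (sphere x 0) = 1" by simp
  have "sph (Suc n) (int q + 1) = (int q + 1) * int q ^ n" for n
    by (induction n rule: induct_nat_012) (auto simp: algebra_simps split: if_splits)
  then have "int (card (sphere x (Suc n))) = int ((q + 1) * q ^ n)"
    using card_sphere_eq[where 'a=int, of x "Suc n"]
    by (simp only: of_nat_add of_nat_mult of_nat_power of_nat_1)
  then show "card (sphere x (Suc n)) = (q + 1) * q ^ n" by (simp only: of_nat_eq_iff)
qed

end

section \<open>Automorphisms of the tree and deck transformations\<close>

context tree
begin

text \<open>Such a map cannot fold a path: if the image of a path from \<open>x\<close> turned back
  at \<open>g z\<close>, its next vertex would be the unique parent of \<open>g z\<close>, which is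
  already the image of the parent of \<open>z\<close>, against injectivity around \<open>z\<close>.
  So distances are preserved, which gives injectivity; connectedness gives surjectivity.\<close>

lemma local_bijection_aut:
  assumes loc: "\<And>z. bij_betw g {w. T z w} {w. T (g z) w}"
  shows "g \<in> graph_aut T"
proof -
  have edge: "T (g a) (g b)" if "T a b" for a b
    using bij_betwE[OF loc[of a]] that by blast
  have dist_g: "dist (g w) (g x) = dist w x" if "dist w x = n" for n w x
    using that
  proof (induction n arbitrary: w rule: less_induct)
    case (less n)
    show ?case
    proof (cases "w = x")
      case False
      define z where "z = parent x w"
      have z: "T w z" "dist w x = Suc (dist z x)" using parent[OF False] by (auto simp: z_def)
      have IHz: "dist (g z) (g x) = dist z x" using less z by auto
      have "dist (g w) (g x) = Suc (dist (g z) (g x))"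
      proof (rule ccontr)
        assume neg: "dist (g w) (g x) \<noteq> Suc (dist (g z) (g x))"
        from dist_nbr_cases[OF edge[OF sym[OF z(1)]], of "g x"] neg
        have gw: "dist (g z) (g x) = Suc (dist (g w) (g x))" by auto
        then have "z \<noteq> x" by auto
        define p where "p = parent x z"
        have p: "T z p" "dist z x = Suc (dist p x)" using parent[OF \<open>z \<noteq> x\<close>] by (auto simp: p_def)
        have "dist (g p) (g x) = dist p x" using less z p by auto
        with gw IHz p have eq: "dist (g p) (g x) = dist (g w) (g x)" by simp
        have "g p = g w"
          by (rule parent_unique[of "g z" _ _ "g x" "dist (g w) (g x)"])
             (use edge[OF p(1)] edge[OF sym[OF z(1)]] eq gw in auto)
        then have "p = w" using loc[of z] p(1) sym[OF z(1)]
          by (auto simp: bij_betw_def dest: inj_onD)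
        then show False using p z by simp
      qed
      then show ?thesis using IHz z by simp
    qed simp
  qed
  have inj: "a = b" if "g a = g b" for a b
    using dist_g[OF refl, of a b] that by simp
  have surj: "\<exists>a. b = g a" for b
  proof (induction rule: connected_induct[of _ "g undefined"])
    case (2 y z)
    then obtain a where "y = g a" by blast
    then have "z \<in> g ` {w. T a w}" using loc[of a] 2 by (auto simp: bij_betw_def)
    then show ?case by blast
  qed auto
  have "T a b" if "T (g a) (g b)" for a b
  proof -
    have "g b \<in> g ` {w. T a w}" using loc[of a] that by (auto simp: bij_betw_def)
    then show ?thesis using inj by blast
  qed
  moreover have "bij g"
  proof (rule bijI)
    show "inj g" using inj by (rule injI)
    show "surj g" unfolding surj_def using surj by blast
  qed
  ultimately show ?thesis using edge unfolding graph_aut_def by blast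
qed

text \<open>
  The automorphism is built outwards from \<open>x\<close>: at \<open>z\<close> the local bijection must agree with the
  value already chosen at the parent \<open>p\<close> of \<open>z\<close>.  At the root, \<open>parent x x = x\<close> is not adjacent
  to \<open>x\<close>, so there is no constraint.
\<close>

lemma aut_extend:
  assumes R: "R x y"
    and ext: "\<And>z z' p p'. R z z' \<Longrightarrow> (T z p \<Longrightarrow> T z' p' \<and> R p p') \<Longrightarrow>
      \<exists>f. bij_betw f {w. T z w} {w. T z' w} \<and> (\<forall>w. T z w \<longrightarrow> R w (f w)) \<and> (T z p \<longrightarrow> f p = p')"
  shows "\<exists>g\<in>graph_aut T. g x = y \<and> (\<forall>z. R z (g z))"
proof -
  define ok where "ok z z' p p' f \<longleftrightarrow> bij_betw f {w. T z w} {w. T z' w} \<and>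
     (\<forall>w. T z w \<longrightarrow> R w (f w)) \<and> (T z p \<longrightarrow> f p = p')" for z z' p p' f
  \<comment> \<open>The choice depends only on a vertex, its parent and their images, so all
    children of one vertex are moved by the same local bijection.\<close>
  define \<beta> where "\<beta> z z' p p' = (SOME f. ok z z' p p' f)" for z z' p p'
  \<comment> \<open>Stage n settles the vertices at distance at most n; beyond that radius the value
    \<open>y\<close> is a placeholder. A value at \<open>w\<close> needs those at its parent and
    grandparent, hence the recursion on the radius.\<close>
  define G where "G = rec_nat (\<lambda>_. y) (\<lambda>n Gn w. if dist w x = Suc n
     then \<beta> (parent x w) (Gn (parent x w)) (parent x (parent x w)) (Gn (parent x (parent x w))) w
     else Gn w)"
  have G0: "G 0 w = y" for w by (simp add: G_def)
  have GS: "G (Suc n) w = (if dist w x = Suc n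
     then \<beta> (parent x w) (G n (parent x w)) (parent x (parent x w)) (G n (parent x (parent x w))) w
     else G n w)" for n w by (simp add: G_def)
  define g where "g w = G (dist w x) w" for w
  have stable: "G n w = g w" if "dist w x \<le> n" for n w
    using that by (induction n) (auto simp: g_def GS le_Suc_eq)
  have par_le: "dist (parent x w) x \<le> dist w x - 1" for w
    by (cases "w = x") (use parent[of w x] in auto)
  have gx: "g x = y" by (simp add: g_def G0)
  have g_rec: "g w = \<beta> (parent x w) (g (parent x w)) (parent x (parent x w))
       (g (parent x (parent x w))) w" if w: "w \<noteq> x" for w
  proof -
    obtain n where n: "dist w x = Suc n" using w by (metis dist_eq_0 not0_implies_Suc)
    have "dist (parent x w) x \<le> n" "dist (parent x (parent x w)) x \<le> n"
      using par_le[of w] par_le[of "parent x w"] n by auto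
    then show ?thesis using n by (simp add: g_def[of w] GS stable)
  qed
  have \<beta>_ok: "ok z (g z) (parent x z) (g (parent x z))
      (\<beta> z (g z) (parent x z) (g (parent x z)))"
    if "R z (g z)" "z \<noteq> x \<Longrightarrow> T (g z) (g (parent x z)) \<and> R (parent x z) (g (parent x z))" for z
    unfolding \<beta>_def
  proof (rule someI_ex[of "ok z (g z) (parent x z) (g (parent x z))"])
    have "z \<noteq> x" if "T z (parent x z)" using that irrefl by auto
    then show "\<exists>f. ok z (g z) (parent x z) (g (parent x z)) f"
      unfolding ok_def by (intro ext) (use that in auto)
  qed
  have inv: "R w (g w) \<and> (w \<noteq> x \<longrightarrow> T (g w) (g (parent x w)))" for w
  proof (induction "dist w x" arbitrary: w rule: less_induct)
    case less
    show ?case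
    proof (cases "w = x")
      case True then show ?thesis using R gx by simp
    next
      case False
      define z where "z = parent x w"
      have z: "T w z" "dist w x = Suc (dist z x)" using parent[OF False] by (auto simp: z_def)
      have "z \<noteq> x \<Longrightarrow> R (parent x z) (g (parent x z))"
        using less[of "parent x z"] parent(2)[of z x] z by simp
      then have "ok z (g z) (parent x z) (g (parent x z)) (\<beta> z (g z) (parent x z) (g (parent x z)))"
        by (intro \<beta>_ok) (use less[of z] z in auto)
      moreover have "g w = \<beta> z (g z) (parent x z) (g (parent x z)) w"
        using g_rec[OF False] by (simp add: z_def)
      ultimately show ?thesis using sym[OF z(1)] unfolding ok_def z_def[symmetric]
        by (auto dest: bij_betwE intro: sym)
    qed
  qed
  have "bij_betw g {w. T z w} {w. T (g z) w}" for z
  proof -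
    have ok: "ok z (g z) (parent x z) (g (parent x z)) (\<beta> z (g z) (parent x z) (g (parent x z)))"
      by (intro \<beta>_ok) (use inv in auto)
    have "g w = \<beta> z (g z) (parent x z) (g (parent x z)) w" if "T z w" for w
    proof (cases "w \<in> children x z")
      case True
      then show ?thesis using g_rec[of w] by (auto simp: children_iff)
    next
      case False
      then have "z \<noteq> x" using that nbrs_root by auto
      with False that have "w = parent x z" using nbrs_nonroot(1) by blast
      then show ?thesis using ok that by (auto simp: ok_def)
    qed
    then have "bij_betw g {w. T z w} B \<longleftrightarrow>
        bij_betw (\<beta> z (g z) (parent x z) (g (parent x z))) {w. T z w} B" for B
      by (intro bij_betw_cong) blast
    then show ?thesis using ok unfolding ok_def by blast
  qed
  then have "g \<in> graph_aut T" by (rule local_bijection_aut)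
  then show ?thesis using gx inv by blast
qed

lemma bij_betw_extend_point:
  assumes "finite A" "finite B" "card A = card B"
  shows "\<exists>f. bij_betw f A B \<and> (p \<in> A \<longrightarrow> p' \<in> B \<longrightarrow> f p = p')"
proof (cases "p \<in> A \<and> p' \<in> B")
  case True
  then have "card (A - {p}) = card (B - {p'})" using assms by simp
  then obtain f where "bij_betw f (A - {p}) (B - {p'})"
    using assms finite_same_card_bij by (metis finite_Diff)
  then have "bij_betw (f(p := p')) (A - {p}) (B - {p'})" by (subst bij_betw_cong[where g = f]) auto
  then have "bij_betw (f(p := p')) (A - {p} \<union> {p}) (B - {p'} \<union> {(f(p := p')) p})"
    by (subst notIn_Un_bij_betw3[symmetric]) auto
  then show ?thesis using True by (intro exI[of _ "f(p := p')"]) (simp add: insert_absorb)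
qed (use assms finite_same_card_bij in blast)

lemma aut_transitive: "\<exists>g\<in>graph_aut T. g x = y"
proof -
  have "\<exists>f. bij_betw f {w. T z w} {w. T z' w} \<and> (T z p \<longrightarrow> f p = p')" if "T z p \<Longrightarrow> T z' p'"
    for z z' p p'
    using bij_betw_extend_point[of "{w. T z w}" "{w. T z' w}" p p'] that by (auto simp: card_nbrs)
  then show ?thesis using aut_extend[of "\<lambda>_ _. True" x y] by simp
qed

text \<open>With \<open>R\<close> the relation of lying in the same fibre, the local bijections are
  forced: follow \<pi> down from the neighbours of \<open>z\<close> and back up to those of
  \<open>z'\<close>. Agreement at the parent is then automatic.\<close>

lemma deck_transitive:
  assumes cov: "covering_map T V E \<pi>" and "\<pi> x = \<pi> y"
  shows "\<exists>g\<in>deck_group T \<pi>. g x = y"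
proof -
  have b: "bij_betw \<pi> {y. T x y} {w. E (\<pi> x) w}" for x using cov by (auto simp: covering_map_def)
  have "\<exists>g\<in>graph_aut T. g x = y \<and> (\<forall>z. \<pi> z = \<pi> (g z))"
  proof (rule aut_extend[of "\<lambda>z z'. \<pi> z = \<pi> z'"])
    fix z z' p p' assume z: "\<pi> z = \<pi> z'" and p: "T z p \<Longrightarrow> T z' p' \<and> \<pi> p = \<pi> p'"
    define f where "f = the_inv_into {w. T z' w} \<pi> \<circ> \<pi>"
    have inj: "inj_on \<pi> {w. T z' w}" and im: "\<pi> ` {w. T z' w} = {w. E (\<pi> z) w}"
      using b[of z'] z by (auto simp: bij_betw_def)
    have "bij_betw f {w. T z w} {w. T z' w}"
      unfolding f_def using b[of z] bij_betw_the_inv_into[OF b[of z']] z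
      by (auto intro: bij_betw_trans)
    moreover have "\<pi> w = \<pi> (f w)" if "T z w" for w
    proof -
      have "\<pi> w \<in> \<pi> ` {w. T z' w}" using im b[of z] that by (auto simp: bij_betw_def)
      then show ?thesis using f_the_inv_into_f[OF inj] by (simp add: f_def)
    qed
    moreover have "f p = p'" if "T z p"
      using p[OF that] the_inv_into_f_f[OF inj, of p'] by (simp add: f_def)
    ultimately show "\<exists>f. bij_betw f {w. T z w} {w. T z' w} \<and> (\<forall>w. T z w \<longrightarrow> \<pi> w = \<pi> (f w)) \<and>
       (T z p \<longrightarrow> f p = p')" by blast
  qed fact
  then show ?thesis by (auto simp: deck_group_def)
qed

end

subsection \<open>Spherical functions and transforms\<close>

context tree
begin

definition eigval :: "complex \<Rightarrow> complex" where
  "eigval l = 2 * of_real (sqrt (real q)) * cos (l * of_real (ln (real q)))"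

lemma card_sphere_pos: "card (sphere x n) > 0"
  using q2 by (cases n) (auto simp: card_sphere)

lemma q_card_sphere: "n > 0 \<Longrightarrow> card (sphere x (Suc n)) = q * card (sphere x n)"
  by (cases n) (auto simp: card_sphere algebra_simps)

text \<open>A radial eigenfunction with value 1 at the centre has sum \<open>sph n t\<close> over
  the sphere of radius n, so its value there must be this average.\<close>

definition sphf :: "'v \<Rightarrow> complex \<Rightarrow> 'v \<Rightarrow> complex" where
  "sphf x t y = sph (dist y x) t / of_nat (card (sphere x (dist y x)))"

lemma sphf_eigen: "(\<Sum>y | T z y. sphf x t y) = t * sphf x t z"
proof -
  have ch: "(\<Sum>y\<in>children x z. sphf x t y) = of_nat (if z = x then q + 1 else q) *
      (sph (Suc (dist z x)) t / of_nat (card (sphere x (Suc (dist z x)))))"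
  proof -
    have "(\<Sum>y\<in>children x z. sphf x t y) = (\<Sum>y\<in>children x z.
      (sph (Suc (dist z x)) t / of_nat (card (sphere x (Suc (dist z x))))))"
      by (intro sum.cong refl) (simp add: sphf_def children_def)
    then show ?thesis by (simp add: card_children)
  qed
  show ?thesis
  proof (cases "z = x")
    case True
    have "1 + of_nat q \<noteq> (0::complex)" using of_nat_neq_0[of q, where 'a=complex] by simp
    then show ?thesis using ch True by (simp add: nbrs_root card_sphere sphf_def)
  next
    case False
    define n where "n = dist (parent x z) x"
    have dz: "dist z x = Suc n" using parent[OF False] by (simp add: n_def)
    define N where "N k = (of_nat (card (sphere x k)) :: complex)" for k
    have N0: "N k \<noteq> 0" for k using card_sphere_pos[of x k] unfolding N_def of_nat_eq_0_iff by linarith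
    have "(\<Sum>y | T z y. sphf x t y) = sphf x t (parent x z) + (\<Sum>y\<in>children x z. sphf x t y)"
      using nbrs_nonroot[OF False] by simp
    also have "\<dots> = sph n t / N n + of_nat q * (sph (Suc (Suc n)) t / N (Suc (Suc n)))"
      using False by (simp add: ch dz N_def[symmetric]) (simp add: sphf_def n_def N_def)
    also have "N (Suc (Suc n)) = of_nat q * N (Suc n)"
      by (simp add: N_def q_card_sphere del: mult_Suc)
    also have "of_nat q * (sph (Suc (Suc n)) t / (of_nat q * N (Suc n))) = sph (Suc (Suc n)) t / N (Suc n)"
      using q2 by simp
    \<comment> \<open>The ratio of consecutive sphere sizes is q + 1 at n = 0 and q afterwards,
      exactly like the coefficient in the recurrence for \<open>sph\<close>.\<close>
    also have "sph n t / N n = (if n = 0 then of_nat q + 1 else of_nat q) * sph n t / N (Suc n)"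
    proof (cases "n = 0")
      case True
      then have "N n = 1" "N (Suc n) = of_nat q + 1" by (auto simp: N_def card_sphere)
      then show ?thesis using True N0[of "Suc n"] by simp
    next
      case False
      then have "N (Suc n) = of_nat q * N n" by (simp add: N_def q_card_sphere)
      then show ?thesis using False q2 by simp
    qed
    also have "(if n = 0 then of_nat q + 1 else of_nat q) * sph n t / N (Suc n) +
        sph (Suc (Suc n)) t / N (Suc n) = t * sph (Suc n) t / N (Suc n)"
      by (simp add: add_divide_distrib[symmetric])
    finally show ?thesis by (simp add: sphf_def dz N_def)
  qed
qed

lemma spherical_function_eq: "spherical_function q T x l = sphf x (eigval l)"
  unfolding spherical_function_def
proof (rule the_equality, unfold eigval_def[symmetric])
  show "radial T x (sphf x (eigval l)) \<and> sphf x (eigval l) x = 1 \<and>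
    (\<forall>z. (\<Sum>y | T z y. sphf x (eigval l) y) = eigval l * sphf x (eigval l) z)"
    by (auto simp: sphf_eigen) (auto simp: radial_def sphf_def)
next
  fix \<omega> assume \<omega>: "radial T x \<omega> \<and> \<omega> x = 1 \<and> (\<forall>z. (\<Sum>y | T z y. \<omega> y) = eigval l * \<omega> z)"
  show "\<omega> = sphf x (eigval l)"
  proof
    fix y
    have "(\<Sum>z\<in>sphere x (dist y x). \<omega> z) = sph (dist y x) (eigval l) * \<omega> x"
      by (rule sum_sphere_eigen) (use \<omega> in auto)
    moreover have "(\<Sum>z\<in>sphere x (dist y x). \<omega> z) = (\<Sum>z\<in>sphere x (dist y x). \<omega> y)"
      by (intro sum.cong refl) (use \<omega> in \<open>unfold radial_def mem_sphere, blast\<close>)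
    ultimately have "of_nat (card (sphere x (dist y x))) * \<omega> y = sph (dist y x) (eigval l)"
      using \<omega> by simp
    moreover have "of_nat (card (sphere x (dist y x))) \<noteq> (0::complex)"
      using card_sphere_pos[of x "dist y x"] unfolding of_nat_eq_0_iff by linarith
    ultimately show "\<omega> y = sphf x (eigval l) y"
      unfolding sphf_def by (metis nonzero_mult_div_cancel_left)
  qed
qed

text \<open>A radial weight is constant on spheres, so after grouping by distance only the sphere
  sums of the other factor matter.\<close>

lemma radial_sum_cong:
  assumes f: "radial T x f" "finite {y. f y \<noteq> (0::complex)}"
    and eq: "\<And>n. (\<Sum>y\<in>sphere x n. g y) = (\<Sum>y\<in>sphere x n. g' y)"
  shows "(\<Sum>y | f y \<noteq> 0. f y * g y) = (\<Sum>y | f y \<noteq> 0. f y * g' y)"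
proof -
  let ?S = "{y. f y \<noteq> 0}"
  have *: "(\<Sum>y\<in>?S. f y * h y) = (\<Sum>n\<in>(\<lambda>y. dist y x) ` ?S. \<Sum>y\<in>{y\<in>?S. dist y x = n}. f y * h y)" for h
    using f(2) by (rule sum.image_gen)
  have "(\<Sum>y\<in>{y\<in>?S. dist y x = n}. f y * g y) = (\<Sum>y\<in>{y\<in>?S. dist y x = n}. f y * g' y)"
    if "n \<in> (\<lambda>y. dist y x) ` ?S" for n
  proof -
    from that obtain z where z: "f z \<noteq> 0" "dist z x = n" by auto
    have fz: "f y = f z" if "dist y x = n" for y using f(1) z that unfolding radial_def by blast
    have "f y \<noteq> 0" if "dist y x = n" for y using fz[OF that] z(1) by metis
    then have s: "{y\<in>?S. dist y x = n} = sphere x n" by auto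
    have "(\<Sum>y\<in>sphere x n. f y * h y) = f z * (\<Sum>y\<in>sphere x n. h y)" for h
      unfolding sum_distrib_left by (rule sum.cong[OF refl]) (metis fz mem_sphere)
    then show ?thesis unfolding s using eq by simp
  qed
  then show ?thesis unfolding * by (rule sum.cong[OF refl])
qed

text \<open>A function of the eigenvalue instead of the spectral parameter: the spherical function
  depends on the latter only through \<open>eigval\<close>, and in the new variable one deals with
  polynomials.\<close>

definition transform :: "'v \<Rightarrow> ('v \<Rightarrow> complex) \<Rightarrow> complex \<Rightarrow> complex" where
  "transform x f t = (\<Sum>y | f y \<noteq> 0. f y * sphf x t y)"

lemma spherical_transform_eq: "spherical_transform q T x f l = transform x f (eigval l)"
  by (simp add: spherical_transform_def transform_def spherical_function_eq)

text \<open>An eigenfunction has the same sphere sums about \<open>x\<close> as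
  \<open>\<psi> x\<close> times the spherical function, and a radial weight sees nothing
  else.\<close>

lemma radial_sum_eigen:
  assumes f: "radial T x f" "finite {y. f y \<noteq> 0}"
    and eig: "\<And>z. (\<Sum>y | T z y. \<psi> y) = t * \<psi> z"
  shows "(\<Sum>y | f y \<noteq> 0. f y * \<psi> y) = transform x f t * \<psi> x"
proof -
  have "(\<Sum>y | f y \<noteq> 0. f y * \<psi> y) = (\<Sum>y | f y \<noteq> 0. f y * (\<psi> x * sphf x t y))"
    using f
  proof (rule radial_sum_cong)
    fix n
    have "(\<Sum>y\<in>sphere x n. \<psi> x * sphf x t y) = \<psi> x * (\<Sum>y\<in>sphere x n. sphf x t y)"
      by (simp add: sum_distrib_left)
    also have "(\<Sum>y\<in>sphere x n. sphf x t y) = sph n t * sphf x t x"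
      by (rule sum_sphere_eigen) (rule sphf_eigen)
    finally show "(\<Sum>y\<in>sphere x n. \<psi> y) = (\<Sum>y\<in>sphere x n. \<psi> x * sphf x t y)"
      using sum_sphere_eigen[of \<psi> t x n] eig by (simp add: sphf_def mult.commute)
  qed
  then show ?thesis by (simp add: transform_def sum_distrib_left sum_distrib_right mult_ac)
qed

definition radial_of :: "'v \<Rightarrow> nat \<Rightarrow> (nat \<Rightarrow> complex) \<Rightarrow> 'v \<Rightarrow> complex" where
  "radial_of x N c y = (if dist y x \<le> N then c (dist y x) else 0)"

lemma radial_radial_of: "radial T x (radial_of x N c)"
  by (auto simp: radial_def radial_of_def)

lemma finite_radial_of: "finite {y. radial_of x N c y \<noteq> 0}"
proof (rule finite_subset)
  show "{y. radial_of x N c y \<noteq> 0} \<subseteq> graph_ball T x N"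
    by (auto simp: radial_of_def graph_ball_def)
qed simp

lemma transform_radial_of: "transform x (radial_of x N c) t = (\<Sum>n\<le>N. c n * sph n t)"
proof -
  have "transform x (radial_of x N c) t = (\<Sum>y\<in>graph_ball T x N. radial_of x N c y * sphf x t y)"
    unfolding transform_def
    by (rule sum.mono_neutral_left[OF finite_ball]) (auto simp: radial_of_def graph_ball_def)
  also have "\<dots> = (\<Sum>n\<le>N. \<Sum>y\<in>sphere x n. radial_of x N c y * sphf x t y)"
    unfolding graph_ball_eq by (rule sum.UNION_disjoint) auto
  also have "\<dots> = (\<Sum>n\<le>N. \<Sum>y\<in>sphere x n. c n * sphf x t y)"
    by (intro sum.cong refl) (auto simp: radial_of_def)
  also have "\<dots> = (\<Sum>n\<le>N. c n * (\<Sum>y\<in>sphere x n. sphf x t y))"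
    by (simp add: sum_distrib_left)
  also have "\<dots> = (\<Sum>n\<le>N. c n * (sph n t * sphf x t x))"
    by (simp add: sum_sphere_eigen[OF sphf_eigen])
  finally show ?thesis by (simp add: sphf_def)
qed

lemma transform_ball: "transform x (indicator (graph_ball T x r)) t = (\<Sum>n\<le>r. sph n t)"
proof -
  have "indicator (graph_ball T x r) = radial_of x r (\<lambda>_. 1)"
    by (auto simp: fun_eq_iff radial_of_def graph_ball_def indicator_def)
  then show ?thesis by (simp add: transform_radial_of)
qed

section \<open>Polynomials in the eigenvalue as transforms of radial functions\<close>

definition sph_span :: "(complex \<Rightarrow> complex) \<Rightarrow> bool" where
  "sph_span F \<longleftrightarrow> (\<exists>N c. \<forall>t. F t = (\<Sum>n\<le>N. c n * sph n t))"

lemma sph_span_add: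
  assumes "sph_span F" "sph_span G" shows "sph_span (\<lambda>t. F t + G t)"
proof -
  obtain M c N d where F: "\<And>t. F t = (\<Sum>n\<le>M. c n * sph n t)" and G: "\<And>t. G t = (\<Sum>n\<le>N. d n * sph n t)"
    using assms unfolding sph_span_def by metis
  have *: "(\<Sum>n\<le>K. a n * sph n t) = (\<Sum>n\<le>max M N. (if n \<le> K then a n else 0) * sph n t)"
    if "K \<le> max M N" for K t and a :: "nat \<Rightarrow> complex"
    by (rule sum.mono_neutral_cong_left) (use that in auto)
  have "F t + G t = (\<Sum>n\<le>max M N. ((if n \<le> M then c n else 0) + (if n \<le> N then d n else 0)) * sph n t)" for t
    using *[of M c t] *[of N d t] by (simp only: F G distrib_right sum.distrib max.cobounded1 max.cobounded2)
  then show ?thesis unfolding sph_span_def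
    by (intro exI[of _ "max M N"]
      exI[of _ "\<lambda>n. (if n \<le> M then c n else 0) + (if n \<le> N then d n else 0)"] allI)
qed

lemma sph_span_scale: assumes "sph_span F" shows "sph_span (\<lambda>t. a * F t)"
proof -
  obtain N c where "\<And>t. F t = (\<Sum>n\<le>N. c n * sph n t)"
    using assms unfolding sph_span_def by metis
  then have "a * F t = (\<Sum>n\<le>N. (a * c n) * sph n t)" for t
    by (simp add: sum_distrib_left mult.assoc)
  then show ?thesis unfolding sph_span_def by (intro exI[of _ N] exI[of _ "\<lambda>n. a * c n"] allI)
qed

lemma sph_span_sph: "sph_span (sph n)"
  unfolding sph_span_def
  by (intro exI[of _ n] exI[of _ "\<lambda>k. if k = n then 1 else 0"])
    (simp add: if_distrib[of "\<lambda>a. a * b" for b] cong: if_cong)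

lemma sph_span_mult_sph: "sph_span (\<lambda>t. (t - a) * sph n t)"
proof -
  \<comment> \<open>The coefficients of the recurrence solved for t * sph n. The value k 0 = 0
    disposes of the truncated index n - 1 at n = 0.\<close>
  define k :: "nat \<Rightarrow> complex" where
    "k = (\<lambda>n. if n = 0 then 0 else if n = 1 then of_nat q + 1 else of_nat q)"
  have "(\<lambda>t. (t - a) * sph n t) = (\<lambda>t. sph (Suc n) t + (k n * sph (n - 1) t + (- a) * sph n t))"
  proof (cases n)
    case (Suc m)
    then show ?thesis by (cases m) (auto simp: k_def fun_eq_iff algebra_simps)
  qed (auto simp: k_def fun_eq_iff)
  then show ?thesis by (simp only:) (intro sph_span_add sph_span_scale sph_span_sph)
qed

lemma sph_span_mult: assumes "sph_span F" shows "sph_span (\<lambda>t. (t - a) * F t)"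
proof -
  obtain N c where F: "F = (\<lambda>t. \<Sum>n\<le>N. c n * sph n t)"
    using assms unfolding sph_span_def by blast
  have "sph_span (\<lambda>t. (t - a) * (\<Sum>n\<le>N. c n * sph n t))"
  proof (induction N)
    case 0 show ?case using sph_span_scale[OF sph_span_mult_sph[of a 0], of "c 0"] by (simp add: mult_ac)
  next
    case (Suc N)
    show ?case
      using sph_span_add[OF Suc sph_span_scale[OF sph_span_mult_sph[of a "Suc N"], of "c (Suc N)"]]
      by (simp add: distrib_left mult_ac del: sph.simps)
  qed
  then show ?thesis using F by simp
qed

text \<open>Linear factors preserve the span of the \<open>sph n\<close>, and every element of that
  span is the transform of some \<open>radial_of\<close>. The resulting functions with prescribed
  zeros are the test functions that locate and weigh the atoms.\<close>

lemma transform_surj: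
  assumes "finite A"
  obtains f where "radial T x f" "finite {y. f y \<noteq> 0}" "\<And>t. transform x f t = (\<Prod>a\<in>A. t - a)"
proof -
  have "sph_span (\<lambda>t. \<Prod>a\<in>A. t - a)"
    using assms
  proof (induction A)
    case empty show ?case unfolding sph_span_def by (intro exI[of _ 0] exI[of _ "\<lambda>_. 1"]) simp
  qed (simp add: sph_span_mult)
  then obtain N c where "\<And>t. (\<Prod>a\<in>A. t - a) = (\<Sum>n\<le>N. c n * sph n t)"
    unfolding sph_span_def by blast
  then show ?thesis
    using that[OF radial_radial_of[of x N c] finite_radial_of[of x N c]] transform_radial_of by simp
qed

end

subsection \<open>The random lattice orbit\<close>

context tree
begin

lemma carrier_aut_group [simp]: "carrier (aut_group T) = graph_aut T"
  by (simp add: aut_group_def)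

lemma aut_in_Bij: "g \<in> graph_aut T \<Longrightarrow> g \<in> Bij UNIV"
  by (simp add: graph_aut_def Bij_def)

lemma aut_mult: "g \<in> graph_aut T \<Longrightarrow> h \<in> graph_aut T \<Longrightarrow> g \<otimes>\<^bsub>aut_group T\<^esub> h = g \<circ> h"
  by (auto simp: aut_group_def BijGroup_def aut_in_Bij compose_def fun_eq_iff)

lemma aut_comp: "g \<in> graph_aut T \<Longrightarrow> h \<in> graph_aut T \<Longrightarrow> g \<circ> h \<in> graph_aut T"
  by (simp add: graph_aut_def bij_comp)

lemma aut_id: "id \<in> graph_aut T"
  by (simp add: graph_aut_def)

lemma aut_inv: assumes "g \<in> graph_aut T" shows "inv_into UNIV g \<in> graph_aut T"
proof -
  have b: "bij g" and e: "T (g x) (g y) \<longleftrightarrow> T x y" for x y using assms by (simp_all add: graph_aut_def)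
  have "T (inv_into UNIV g x) (inv_into UNIV g y) \<longleftrightarrow> T x y" for x y
    using e[of "inv_into UNIV g x" "inv_into UNIV g y"] b by (simp add: bij_is_surj surj_f_inv_f)
  then show ?thesis using b by (simp add: graph_aut_def bij_imp_bij_inv)
qed

lemma aut_m_inv: assumes "g \<in> graph_aut T" shows "inv\<^bsub>aut_group T\<^esub> g = inv_into UNIV g"
  unfolding m_inv_def
proof (rule the_equality)
  have one: "\<one>\<^bsub>aut_group T\<^esub> = id" by (auto simp: aut_group_def BijGroup_def)
  have b: "bij g" using assms by (simp add: graph_aut_def)
  show "inv_into UNIV g \<in> carrier (aut_group T) \<and> g \<otimes>\<^bsub>aut_group T\<^esub> inv_into UNIV g = \<one>\<^bsub>aut_group T\<^esub> \<and>
      inv_into UNIV g \<otimes>\<^bsub>aut_group T\<^esub> g = \<one>\<^bsub>aut_group T\<^esub>"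
    using assms b by (simp add: aut_mult aut_inv one bij_is_inj bij_is_surj flip: surj_iff inj_iff)
  fix h assume "h \<in> carrier (aut_group T) \<and> g \<otimes>\<^bsub>aut_group T\<^esub> h = \<one>\<^bsub>aut_group T\<^esub> \<and>
      h \<otimes>\<^bsub>aut_group T\<^esub> g = \<one>\<^bsub>aut_group T\<^esub>"
  then have "h \<in> graph_aut T" "g \<otimes>\<^bsub>aut_group T\<^esub> h = id" "h \<otimes>\<^bsub>aut_group T\<^esub> g = id"
    by (simp_all add: one)
  then have "g \<circ> h = id" "h \<circ> g = id" using assms by (simp_all add: aut_mult)
  then show "h = inv_into UNIV g" by (metis inv_unique_comp)
qed

lemma aut_eval_continuous: "continuous_map (aut_topology T) (discrete_topology UNIV) (\<lambda>g. g x)"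
  unfolding aut_topology_def
  by (intro continuous_map_from_subtopology continuous_map_product_projection) simp

lemma aut_right_mult_continuous:
  assumes "g \<in> graph_aut T"
  shows "continuous_map (aut_topology T) (aut_topology T) (\<lambda>h. h \<circ> g)"
proof -
  have "continuous_map (aut_topology T) (product_topology (\<lambda>_. discrete_topology UNIV) UNIV) (\<lambda>h. h \<circ> g)"
    unfolding continuous_map_componentwise_UNIV by (simp add: aut_eval_continuous)
  then show ?thesis
    using assms by (subst (2) aut_topology_def)
      (auto simp: continuous_map_in_subtopology aut_topology_def aut_comp)
qed

lemma topspace_aut_topology [simp]: "topspace (aut_topology T) = graph_aut T"
  by (simp add: aut_topology_def)

end

locale lattice_orbit = tree q T for q and T :: "'v \<Rightarrow> 'v \<Rightarrow> bool" +
  fixes V :: "'w set" and E \<pi> m and x\<^sub>0 :: 'v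
  assumes finite_V: "finite V" and E_sym: "E v w \<Longrightarrow> E w v"
    and covering: "covering_map T V E \<pi>"
    and invariant: "invariant_coset_probability T (deck_group T \<pi>) m"
begin

lemma \<pi>_nbrs: "bij_betw \<pi> {y. T x y} {w. E (\<pi> x) w}"
  using covering by (simp add: covering_map_def)

lemma \<pi>_in [simp]: "\<pi> x \<in> V"
  using covering by (auto simp: covering_map_def)

lemma \<pi>_surj: "v \<in> V \<Longrightarrow> \<exists>x. v = \<pi> x"
  using covering by (auto simp: covering_map_def)

section \<open>Right cosets of the deck group and the labellings they induce\<close>

abbreviation \<Gamma> where "\<Gamma> \<equiv> deck_group T \<pi>"
abbreviation cosets where "cosets \<equiv> rcosets\<^bsub>aut_group T\<^esub> \<Gamma>"

lemma \<Gamma>_aut: "\<gamma> \<in> \<Gamma> \<Longrightarrow> \<gamma> \<in> graph_aut T"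
  by (simp add: deck_group_def)

lemma coset_mult_eq:
  assumes "H \<subseteq> graph_aut T" "g \<in> graph_aut T"
  shows "H #>\<^bsub>aut_group T\<^esub> g = (\<lambda>\<gamma>. \<gamma> \<circ> g) ` H"
  using assms by (force simp: r_coset_def aut_mult)

lemma cosets_eq: "cosets = (\<lambda>g. (\<lambda>\<gamma>. \<gamma> \<circ> g) ` \<Gamma>) ` graph_aut T"
  unfolding RCOSETS_def using \<Gamma>_aut by (auto simp: coset_mult_eq subset_iff)

lemma coset_subset: "C \<in> cosets \<Longrightarrow> C \<subseteq> graph_aut T"
  by (auto simp: cosets_eq \<Gamma>_aut aut_comp)

lemma coset_translate:
  assumes "C \<in> cosets" "g \<in> graph_aut T"
  shows "C #>\<^bsub>aut_group T\<^esub> g \<in> cosets" "h \<in> C \<Longrightarrow> h \<circ> g \<in> C #>\<^bsub>aut_group T\<^esub> g"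
proof -
  obtain d where d: "d \<in> graph_aut T" "C = (\<lambda>\<gamma>. \<gamma> \<circ> d) ` \<Gamma>" using assms(1) by (auto simp: cosets_eq)
  have "C #>\<^bsub>aut_group T\<^esub> g = (\<lambda>\<gamma>. \<gamma> \<circ> (d \<circ> g)) ` \<Gamma>"
    using coset_mult_eq[OF coset_subset[OF assms(1)] assms(2)] d by (simp add: image_image comp_assoc)
  then show "C #>\<^bsub>aut_group T\<^esub> g \<in> cosets" using aut_comp[OF d(1) assms(2)] by (auto simp: cosets_eq)
  show "h \<in> C \<Longrightarrow> h \<circ> g \<in> C #>\<^bsub>aut_group T\<^esub> g"
    using coset_mult_eq[OF coset_subset[OF assms(1)] assms(2)] by auto
qed

lemma coset_nonempty: assumes "C \<in> cosets" obtains h where "h \<in> C" "h \<in> graph_aut T"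
proof -
  have "id \<in> \<Gamma>" by (simp add: deck_group_def aut_id)
  then have "C \<noteq> {}" using assms by (auto simp: cosets_eq)
  then show ?thesis using that coset_subset[OF assms] by blast
qed

lemma coset_of_aut: "g \<in> graph_aut T \<Longrightarrow> \<exists>C\<in>cosets. g \<in> C"
proof -
  assume g: "g \<in> graph_aut T"
  have "id \<in> \<Gamma>" by (simp add: deck_group_def aut_id)
  then have "g \<in> (\<lambda>\<gamma>. \<gamma> \<circ> g) ` \<Gamma>" by (rule image_eqI[rotated]) simp
  then show ?thesis using g by (auto simp: cosets_eq)
qed

text \<open>A coset \<Gamma>g is viewed as the covering map \<pi> after g, a random labelling of the
  tree by vertices of the finite graph. Deck transformations preserve \<pi>, so the chosen
  representative does not matter (\<open>label_eq\<close>).\<close>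

definition label where "label C x = \<pi> ((SOME h. h \<in> C) x)"

lemma label_eq: assumes "C \<in> cosets" "h \<in> C" shows "label C x = \<pi> (h x)"
proof -
  obtain d where d: "C = (\<lambda>\<gamma>. \<gamma> \<circ> d) ` \<Gamma>" using assms(1) by (auto simp: cosets_eq)
  have "\<pi> (h x) = \<pi> (d x)" if "h \<in> C" for h
    using that d by (auto simp: deck_group_def)
  then show ?thesis unfolding label_def using assms(2) someI[of "\<lambda>h. h \<in> C" h] by metis
qed

lemma label_in [simp]: "label C x \<in> V"
  by (simp add: label_def)

lemma label_translate:
  assumes "C \<in> cosets" "g \<in> graph_aut T"
  shows "label (C #>\<^bsub>aut_group T\<^esub> g) x = label C (g x)"
proof -
  obtain h where h: "h \<in> C" using assms(1) by (rule coset_nonempty)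
  show ?thesis
    using label_eq[OF coset_translate(1)[OF assms] coset_translate(2)[OF assms h]]
      label_eq[OF assms(1) h] by simp
qed

definition orbit_of :: "('v \<Rightarrow> 'v) set \<Rightarrow> 'v \<Rightarrow> real" where
  "orbit_of C = indicator ((\<lambda>h. (inv\<^bsub>aut_group T\<^esub> h) x\<^sub>0) ` C)"

text \<open>If \<open>h y\<close> lies over \<open>\<pi> x\<^sub>0\<close>, a deck transformation
  carries it to \<open>x\<^sub>0\<close>, and composing \<open>h\<close> with it stays in the coset.
  So the lattice orbit is a whole fibre of the labelling and can be read off from labels.\<close>

lemma orbit_of_eq:
  assumes "C \<in> cosets"
  shows "orbit_of C y = of_bool (label C y = \<pi> x\<^sub>0)"
proof -
  have "y \<in> (\<lambda>h. (inv\<^bsub>aut_group T\<^esub> h) x\<^sub>0) ` C \<longleftrightarrow> (\<exists>h\<in>C. h y = x\<^sub>0)"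
  proof -
    have "y = (inv\<^bsub>aut_group T\<^esub> h) x\<^sub>0 \<longleftrightarrow> h y = x\<^sub>0" if "h \<in> C" for h
    proof -
      have "h \<in> graph_aut T" using that coset_subset[OF assms] by blast
      then have "bij h" by (simp add: graph_aut_def)
      then show ?thesis unfolding aut_m_inv[OF \<open>h \<in> graph_aut T\<close>]
        by (metis bij_inv_eq_iff)
    qed
    then show ?thesis by (simp add: image_iff cong: bex_cong)
  qed
  also have "\<dots> \<longleftrightarrow> label C y = \<pi> x\<^sub>0"
  proof
    assume "label C y = \<pi> x\<^sub>0"
    obtain d where d: "C = (\<lambda>\<gamma>. \<gamma> \<circ> d) ` \<Gamma>" using assms by (auto simp: cosets_eq)
    obtain h where h: "h \<in> C" using assms by (rule coset_nonempty)
    then obtain \<gamma> where \<gamma>: "\<gamma> \<in> \<Gamma>" "h = \<gamma> \<circ> d" using d by auto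
    have "\<pi> (h y) = \<pi> x\<^sub>0" using label_eq[OF assms h, of y] \<open>label C y = \<pi> x\<^sub>0\<close> by simp
    then obtain \<delta> where \<delta>: "\<delta> \<in> \<Gamma>" "\<delta> (h y) = x\<^sub>0" using deck_transitive[OF covering] by blast
    have "\<delta> \<circ> \<gamma> \<in> \<Gamma>" using \<delta>(1) \<gamma>(1) by (auto simp: deck_group_def aut_comp)
    then have "(\<delta> \<circ> \<gamma>) \<circ> d \<in> C" unfolding d by (rule imageI)
    then show "\<exists>h\<in>C. h y = x\<^sub>0" using \<delta>(2) \<gamma>(2) by (intro bexI[of _ "(\<delta> \<circ> \<gamma>) \<circ> d"]) auto
  qed (use label_eq[OF assms] in auto)
  finally show ?thesis by (simp add: orbit_of_def indicator_def)
qed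

text \<open>The union of the cosets satisfying a condition on labels is the set of automorphisms
  satisfying the same condition, so openness is decided in the automorphism group.\<close>

lemma open_cosets_Collect:
  "openin (aut_topology T) {g \<in> graph_aut T. Q (\<lambda>x. \<pi> (g x))} \<Longrightarrow>
   {C \<in> cosets. Q (label C)} \<in> {U. U \<subseteq> cosets \<and> openin (aut_topology T) (\<Union>U)}"
proof -
  have "\<Union>{C \<in> cosets. Q (label C)} = {g \<in> graph_aut T. Q (\<lambda>x. \<pi> (g x))}"
  proof (intro equalityI subsetI)
    fix g assume "g \<in> \<Union>{C \<in> cosets. Q (label C)}"
    then obtain C where C: "C \<in> cosets" "Q (label C)" "g \<in> C" by blast
    then have "label C = (\<lambda>x. \<pi> (g x))" using label_eq by blast
    then show "g \<in> {g \<in> graph_aut T. Q (\<lambda>x. \<pi> (g x))}" using C coset_subset by auto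
  next
    fix g assume g: "g \<in> {g \<in> graph_aut T. Q (\<lambda>x. \<pi> (g x))}"
    then obtain C where C: "C \<in> cosets" "g \<in> C" using coset_of_aut by blast
    then have "label C = (\<lambda>x. \<pi> (g x))" using label_eq by blast
    then show "g \<in> \<Union>{C \<in> cosets. Q (label C)}" using C g by auto
  qed
  then show "openin (aut_topology T) {g \<in> graph_aut T. Q (\<lambda>x. \<pi> (g x))} \<Longrightarrow>
   {C \<in> cosets. Q (label C)} \<in> {U. U \<subseteq> cosets \<and> openin (aut_topology T) (\<Union>U)}" by auto
qed

lemma sets_m: "sets m = sets (coset_space T \<Gamma>)"
  using invariant by (simp add: invariant_coset_probability_def)

lemma space_m: "space m = cosets"
  using sets_eq_imp_space_eq[OF sets_m] by (simp add: coset_space_def space_measure_of_conv)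

lemma open_in_sets:
  assumes "A \<in> {U. U \<subseteq> cosets \<and> openin (aut_topology T) (\<Union>U)}"
  shows "A \<in> sets m"
  unfolding sets_m coset_space_def using assms by (subst sets_measure_of) auto

sublocale prob_m: finite_measure m
  by standard (use invariant in \<open>simp add: invariant_coset_probability_def\<close>)

lemma measure_m: "measure m (space m) = 1"
  using invariant by (simp add: invariant_coset_probability_def measure_def)

lemma translate_measurable:
  assumes "g \<in> graph_aut T"
  shows "(\<lambda>C. C #>\<^bsub>aut_group T\<^esub> g) \<in> measurable m m"
proof -
  have "(\<lambda>C. C #>\<^bsub>aut_group T\<^esub> g) \<in> measurable m (coset_space T \<Gamma>)"
    unfolding coset_space_def
  proof (rule measurable_measure_of)
    show "(\<lambda>C. C #>\<^bsub>aut_group T\<^esub> g) \<in> space m \<rightarrow> cosets"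
      using coset_translate(1) assms by (auto simp: space_m)
    show "(\<lambda>C. C #>\<^bsub>aut_group T\<^esub> g) -` U \<inter> space m \<in> sets m"
      if U: "U \<in> {U. U \<subseteq> cosets \<and> openin (aut_topology T) (\<Union> U)}" for U
    proof -
      let ?P = "(\<lambda>C. C #>\<^bsub>aut_group T\<^esub> g) -` U \<inter> space m"
      \<comment> \<open>The quotient topology is tested on unions: the union of the preimage is the
        preimage of the union under right multiplication by \<open>g\<close>, which is
        continuous.\<close>
      have "\<Union>?P = {h \<in> topspace (aut_topology T). h \<circ> g \<in> \<Union>U}"
      proof (intro equalityI subsetI)
        fix h assume "h \<in> \<Union>?P"
        then show "h \<in> {h \<in> topspace (aut_topology T). h \<circ> g \<in> \<Union>U}"
          using coset_translate(2)[OF _ assms] coset_subset by (auto simp: space_m)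
      next
        fix h assume h: "h \<in> {h \<in> topspace (aut_topology T). h \<circ> g \<in> \<Union>U}"
        then obtain D where D: "D \<in> U" "h \<circ> g \<in> D" by auto
        then have Dc: "D \<in> cosets" using U by auto
        have bg: "g \<circ> inv_into UNIV g = id" "inv_into UNIV g \<circ> g = id"
          using assms bij_is_surj[of g] bij_is_inj[of g] unfolding surj_iff inj_iff graph_aut_def by auto
        define C where "C = D #>\<^bsub>aut_group T\<^esub> inv_into UNIV g"
        have C: "C \<in> cosets" unfolding C_def using Dc aut_inv[OF assms] by (rule coset_translate)
        have "(h \<circ> g) \<circ> inv_into UNIV g \<in> C" unfolding C_def using Dc aut_inv[OF assms] D(2) by (rule coset_translate)
        then have hC: "h \<in> C" using bg by (simp add: comp_assoc)
        have "C #>\<^bsub>aut_group T\<^esub> g = (\<lambda>\<gamma>. \<gamma> \<circ> g) ` ((\<lambda>\<gamma>. \<gamma> \<circ> inv_into UNIV g) ` D)"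
          using coset_mult_eq[OF coset_subset[OF C] assms]
            coset_mult_eq[OF coset_subset[OF Dc] aut_inv[OF assms]] by (simp add: C_def)
        also have "\<dots> = D" using bg by (simp add: image_image comp_assoc)
        finally show "h \<in> \<Union>?P" using hC C D by (auto simp: space_m)
      qed
      moreover have "openin (aut_topology T) {h \<in> topspace (aut_topology T). h \<circ> g \<in> \<Union>U}"
        using U by (intro openin_continuous_map_preimage[OF aut_right_mult_continuous[OF assms]]) auto
      ultimately show ?thesis by (intro open_in_sets) (auto simp: space_m)
    qed
  qed auto
  then show ?thesis using measurable_cong_sets[OF refl sets_m] by blast
qed

section \<open>The distribution of the label at a vertex\<close>

lemma label_measurable: "{C \<in> space m. label C x = v} \<in> sets m"
proof -
  have "openin (aut_topology T) {g \<in> topspace (aut_topology T). g x \<in> {y. \<pi> y = v}}"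
    by (rule openin_continuous_map_preimage[OF aut_eval_continuous]) simp
  then show ?thesis
    using open_in_sets[OF open_cosets_Collect[of "\<lambda>l. l x = v"]] by (simp add: space_m)
qed

definition law where "law x v = measure m {C \<in> space m. label C x = v}"

lemma law_aut: assumes "g \<in> graph_aut T" shows "law (g x) v = law x v"
proof -
  let ?A = "{C \<in> space m. label C x = v}"
  have "distr m m (\<lambda>C. C #>\<^bsub>aut_group T\<^esub> g) = m"
    using invariant assms by (simp add: invariant_coset_probability_def)
  then have "law x v = measure (distr m m (\<lambda>C. C #>\<^bsub>aut_group T\<^esub> g)) ?A" by (simp add: law_def)
  also have "\<dots> = measure m ((\<lambda>C. C #>\<^bsub>aut_group T\<^esub> g) -` ?A \<inter> space m)"
    by (rule measure_distr[OF translate_measurable[OF assms] label_measurable])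
  also have "(\<lambda>C. C #>\<^bsub>aut_group T\<^esub> g) -` ?A \<inter> space m = {C \<in> space m. label C (g x) = v}"
    using coset_translate(1) label_translate assms by (auto simp: space_m)
  finally show ?thesis by (simp add: law_def)
qed

lemma law_indep: "law x v = law y v"
  using aut_transitive[of y x] law_aut by metis

lemma expectation_label:
  fixes \<phi> :: "'w \<Rightarrow> 'b::{banach, second_countable_topology}"
  shows "(\<integral>C. \<phi> (label C x) \<partial>m) = (\<Sum>v\<in>V. law x v *\<^sub>R \<phi> v)"
    and "integrable m (\<lambda>C. \<phi> (label C x))"
proof -
  have *: "\<phi> (label C x) = (\<Sum>v\<in>V. indicat_real {C \<in> space m. label C x = v} C *\<^sub>R \<phi> v)"
    if "C \<in> space m" for C
    using that finite_V by (simp add: indicator_def of_bool_def if_distrib[of "\<lambda>a. a *\<^sub>R b" for b] cong: if_cong)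
  have fin: "emeasure m A < top_class.top" for A
    using prob_m.emeasure_finite[of A] unfolding infinity_ennreal_def top.not_eq_extremum .
  have int: "integrable m (\<lambda>C. indicat_real {C \<in> space m. label C x = v} C *\<^sub>R \<phi> v)" for v
    using label_measurable[of x v] by (intro integrable_scaleR_left integrable_real_indicator)
      (simp_all add: fin)
  show "integrable m (\<lambda>C. \<phi> (label C x))"
    using Bochner_Integration.integrable_cong[OF refl *, of m] int by (simp add: integrable_sum)
  have "(\<integral>C. \<phi> (label C x) \<partial>m) =
      (\<integral>C. (\<Sum>v\<in>V. indicat_real {C \<in> space m. label C x = v} C *\<^sub>R \<phi> v) \<partial>m)"
    by (rule Bochner_Integration.integral_cong[OF refl *])
  also have "\<dots> = (\<Sum>v\<in>V. \<integral>C. indicat_real {C \<in> space m. label C x = v} C *\<^sub>R \<phi> v \<partial>m)"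
    by (rule Bochner_Integration.integral_sum[OF int])
  also have "\<dots> = (\<Sum>v\<in>V. law x v *\<^sub>R \<phi> v)"
    unfolding law_def using label_measurable[of x] int
    by (intro sum.cong refl) (simp add: fin)
  finally show "(\<integral>C. \<phi> (label C x) \<partial>m) = (\<Sum>v\<in>V. law x v *\<^sub>R \<phi> v)" .
qed

text \<open>A labelling is \<pi> after an automorphism, hence again a local bijection from the
  neighbours of \<open>x\<close> to those of its label.\<close>

lemma sum_label_nbrs:
  assumes "C \<in> cosets"
  shows "(\<Sum>y | T x y. \<phi> (label C y)) = (\<Sum>w | E (label C x) w. \<phi> w)"
proof -
  obtain h where h: "h \<in> C" "h \<in> graph_aut T" using assms by (rule coset_nonempty)
  have "(\<Sum>y | T x y. \<phi> (label C y)) = (\<Sum>y | T x y. \<phi> (\<pi> (h y)))"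
    by (simp add: label_eq[OF assms h(1)])
  also have "\<dots> = (\<Sum>z | T (h x) z. \<phi> (\<pi> z))"
  proof (rule sum.reindex_bij_betw)
    have b: "bij h" "T (h x) (h y) \<longleftrightarrow> T x y" for x y using h(2) by (auto simp: graph_aut_def)
    have "h ` {y. T x y} = {z. T (h x) z}"
    proof (intro equalityI subsetI)
      fix z assume "z \<in> {z. T (h x) z}"
      moreover have "z = h (inv_into UNIV h z)" using b(1) by (simp add: bij_is_surj surj_f_inv_f)
      ultimately show "z \<in> h ` {y. T x y}" using b(2) by (metis image_eqI mem_Collect_eq)
    qed (use b(2) in auto)
    moreover have "inj_on h {y. T x y}" using b(1) by (meson bij_is_inj inj_on_subset subset_UNIV)
    ultimately show "bij_betw h {y. T x y} {z. T (h x) z}" by (simp add: bij_betw_def)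
  qed
  also have "\<dots> = (\<Sum>w | E (\<pi> (h x)) w. \<phi> w)"
    by (rule sum.reindex_bij_betw[OF \<pi>_nbrs])
  finally show ?thesis by (simp add: label_eq[OF assms h(1)])
qed

lemma E_in_V: assumes "v \<in> V" shows "{w. E v w} \<subseteq> V"
proof -
  obtain x where "v = \<pi> x" using \<pi>_surj assms by blast
  then have "{w. E v w} = \<pi> ` {y. T x y}" using \<pi>_nbrs[of x] by (simp add: bij_betw_def)
  then show ?thesis by auto
qed

text \<open>Both sides are the expected number of neighbours of \<open>x\<close> labelled
  \<open>v\<close>: the law is the same at all q + 1 neighbours, while given the label u of
  \<open>x\<close> the number is 1 or 0 according to whether u and \<open>v\<close> are
  adjacent.\<close>

lemma law_harmonic:
  assumes "v \<in> V"
  shows "(\<Sum>w | E v w. law x w) = real (q + 1) * law x v"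
proof -
  let ?\<phi> = "\<lambda>w. of_bool (w = v) :: real"
  have law: "law y v = (\<integral>C. ?\<phi> (label C y) \<partial>m)" for y
    using finite_V assms unfolding expectation_label(1)[of ?\<phi> y]
    by (simp add: of_bool_def if_distrib[of "\<lambda>a. b * a" for b] cong: if_cong)
  have "real (q + 1) * law x v = (\<Sum>y | T x y. law y v)"
  proof -
    have "(\<Sum>y | T x y. law y v) = (\<Sum>y | T x y. law x v)" by (intro sum.cong refl law_indep)
    then show ?thesis using card_nbrs[of x] by simp
  qed
  also have "\<dots> = (\<integral>C. (\<Sum>y | T x y. ?\<phi> (label C y)) \<partial>m)"
    unfolding law by (rule Bochner_Integration.integral_sum[symmetric]) (rule expectation_label(2))
  also have "\<dots> = (\<integral>C. (\<Sum>w | E (label C x) w. ?\<phi> w) \<partial>m)"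
    by (intro Bochner_Integration.integral_cong refl sum_label_nbrs) (simp add: space_m)
  also have "\<dots> = (\<Sum>u\<in>V. law x u * (\<Sum>w | E u w. ?\<phi> w))"
    by (simp add: expectation_label(1)[where \<phi> = "\<lambda>u. \<Sum>w | E u w. ?\<phi> w"])
  also have "\<dots> = (\<Sum>u\<in>V. if E v u then law x u else 0)"
  proof (intro sum.cong refl)
    fix u assume "u \<in> V"
    then have "finite {w. E u w}" using E_in_V finite_V finite_subset by blast
    then show "law x u * (\<Sum>w | E u w. ?\<phi> w) = (if E v u then law x u else 0)"
      using E_sym by (auto simp: of_bool_def)
  qed
  also have "\<dots> = (\<Sum>u | E v u. law x u)"
    using E_in_V[OF assms] finite_V by (subst sum.inter_filter[symmetric]) (auto intro: sum.cong)
  finally show ?thesis by simp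
qed

text \<open>Maximum principle: where the law is maximal its average over the neighbours is the same
  maximum, so every neighbour attains it. The induction runs along the tree, whose connectedness
  passes to the finite graph; total mass one fixes the constant.\<close>

lemma law_uniform: assumes "v \<in> V" shows "law x v = 1 / card V"
proof -
  define M where "M = Max (law x ` V)"
  have "V \<noteq> {}" using assms by auto
  then have fin: "finite (law x ` V)" "law x ` V \<noteq> {}" using finite_V by auto
  have le: "law x w \<le> M" if "w \<in> V" for w unfolding M_def using fin that by auto
  obtain u where u: "u \<in> V" "law x u = M" using Max_in[OF fin] unfolding M_def by auto
  obtain z where z: "u = \<pi> z" using \<pi>_surj u by blast
  have "law x (\<pi> y) = M" for y
  proof (induction rule: connected_induct[of _ z])
    case 1 show ?case using u z by simp
  next
    case (2 y y')
    have "(\<Sum>w\<in>{w. E (\<pi> y) w}. M - law x w) = 0"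
    proof -
      have "card {w. E (\<pi> y) w} = q + 1" using bij_betw_same_card[OF \<pi>_nbrs[of y]] card_nbrs by simp
      then show ?thesis using law_harmonic[of "\<pi> y" x] 2(1) by (simp add: sum_subtractf)
    qed
    moreover have "finite {w. E (\<pi> y) w}" using E_in_V[of "\<pi> y"] finite_V finite_subset by auto
    moreover have "M - law x w \<ge> 0" if "w \<in> {w. E (\<pi> y) w}" for w
      using le E_in_V[of "\<pi> y"] that by auto
    ultimately have "\<forall>w\<in>{w. E (\<pi> y) w}. M - law x w = 0" by (subst (asm) sum_nonneg_eq_0_iff) auto
    moreover have "E (\<pi> y) (\<pi> y')" using \<pi>_nbrs[of y] 2(2) by (auto simp: bij_betw_def)
    ultimately show ?case by simp
  qed
  then have const: "law x w = M" if "w \<in> V" for w using \<pi>_surj[OF that] by blast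
  have "1 = (\<integral>C. (1::real) \<partial>m)" using measure_m by simp
  also have "\<dots> = (\<Sum>w\<in>V. law x w)" using expectation_label(1)[of "\<lambda>_. 1::real" x] by simp
  also have "\<dots> = card V * M" using const by simp
  finally show ?thesis using const assms finite_V \<open>V \<noteq> {}\<close> by (simp add: field_simps)
qed

lemma expectation_label_uniform:
  fixes \<phi> :: "'w \<Rightarrow> complex"
  shows "(\<integral>C. \<phi> (label C x) \<partial>m) = (\<Sum>v\<in>V. \<phi> v) / card V"
  by (simp add: expectation_label(1) law_uniform scaleR_conv_of_real sum_divide_distrib divide_inverse mult.commute
      sum_distrib_right)

lemma orbit_measurable: "orbit_of \<in> measurable m configurations"
  unfolding configurations_def
proof (rule measurable_restrict_space2)
  show "orbit_of \<in> space m \<rightarrow> {p. \<forall>x. 0 \<le> p x}" by (auto simp: orbit_of_def)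
  show "orbit_of \<in> borel_measurable m"
  proof (rule borel_measurableI)
    fix U :: "('v \<Rightarrow> real) set" assume U: "open U"
    \<comment> \<open>Each coordinate depends on g only through g y, a continuous map to a discrete
      space. Preimages of open sets of configurations are therefore open sets of cosets.\<close>
    have "continuous_map (aut_topology T) euclidean (\<lambda>g y. of_bool (\<pi> (g y) = \<pi> x\<^sub>0) :: real)"
      unfolding euclidean_product_topology[symmetric] continuous_map_componentwise_UNIV
    proof
      fix y
      have "continuous_map (aut_topology T) euclidean ((\<lambda>z. of_bool (\<pi> z = \<pi> x\<^sub>0) :: real) \<circ> (\<lambda>g. g y))"
        by (rule continuous_map_compose[OF aut_eval_continuous]) simp
      then show "continuous_map (aut_topology T) euclidean (\<lambda>g. of_bool (\<pi> (g y) = \<pi> x\<^sub>0) :: real)"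
        by (simp add: comp_def)
    qed
    then have "openin (aut_topology T)
        {g \<in> topspace (aut_topology T). (\<lambda>y. of_bool (\<pi> (g y) = \<pi> x\<^sub>0) :: real) \<in> U}"
      by (rule openin_continuous_map_preimage) (use U in simp)
    then have "{C \<in> cosets. (\<lambda>y. of_bool (label C y = \<pi> x\<^sub>0) :: real) \<in> U} \<in> sets m"
      by (intro open_in_sets open_cosets_Collect) simp
    also have "{C \<in> cosets. (\<lambda>y. of_bool (label C y = \<pi> x\<^sub>0) :: real) \<in> U} = orbit_of -` U \<inter> space m"
    proof -
      have "orbit_of C = (\<lambda>y. of_bool (label C y = \<pi> x\<^sub>0))" if "C \<in> cosets" for C
        using orbit_of_eq[OF that] by auto
      then show ?thesis by (auto simp: space_m)
    qed
    finally show "orbit_of -` U \<inter> space m \<in> sets m" .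
  qed
qed

lemma linear_statistic_measurable:
  fixes f :: "'v \<Rightarrow> complex"
  shows "linear_statistic f \<in> borel_measurable configurations"
proof -
  have "(\<lambda>p. p y) \<in> borel_measurable (borel :: ('v \<Rightarrow> real) measure)" for y
    by (intro borel_measurable_continuous_onI continuous_on_product_coordinates)
  then have M: "(\<lambda>p. p y) \<in> borel_measurable (configurations :: ('v \<Rightarrow> real) measure)" for y
    unfolding configurations_def by (rule measurable_restrict_space1)
  have "(\<lambda>p. complex_of_real (p y)) \<in> borel_measurable configurations" for y :: 'v
    by (rule measurable_compose[OF M[of y]]) simp
  then have "(\<lambda>p. complex_of_real (p y) * f y) \<in> borel_measurable configurations" for y :: 'v
    by (intro borel_measurable_times borel_measurable_const)
  then show ?thesis unfolding linear_statistic_def[abs_def] by (rule borel_measurable_sum)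
qed

lemma integral_random_lattice_orbit:
  assumes [measurable]: "(F :: _ \<Rightarrow> complex) \<in> borel_measurable configurations"
  shows "(\<integral>p. F p \<partial>random_lattice_orbit T x\<^sub>0 m) =
    (\<integral>C. F (\<lambda>y. of_bool (label C y = \<pi> x\<^sub>0)) \<partial>m)"
proof -
  have "(\<integral>p. F p \<partial>random_lattice_orbit T x\<^sub>0 m) = (\<integral>C. F (orbit_of C) \<partial>m)"
    unfolding random_lattice_orbit_def orbit_of_def[symmetric]
    by (rule integral_distr[OF orbit_measurable assms])
  also have "\<dots> = (\<integral>C. F (\<lambda>y. of_bool (label C y = \<pi> x\<^sub>0)) \<partial>m)"
  proof (intro Bochner_Integration.integral_cong refl arg_cong[where f = F] ext)
    fix C y assume "C \<in> space m"
    then show "orbit_of C y = of_bool (label C y = \<pi> x\<^sub>0)" using orbit_of_eq by (simp add: space_m)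
  qed
  finally show ?thesis .
qed

end

subsection \<open>The diffraction measure\<close>

context tree
begin

section \<open>Eigenvalues as points of the spectral set\<close>

abbreviation L where "L \<equiv> ln (real q)"

lemma L_pos: "L > 0"
  using q2 by (simp add: ln_gt_zero)

lemma cos_i_of_real: "cos (\<i> * of_real s) = complex_of_real (cosh s)"
proof -
  have "exp (- complex_of_real s) = of_real (exp (- s))" by (simp flip: exp_of_real)
  then show ?thesis
    by (simp add: cosh_conv_cos[symmetric] cosh_field_def flip: exp_of_real)
qed

lemma eigval_imag: "eigval (\<i> * of_real t) = of_real (2 * sqrt (real q) * cosh (t * L))"
proof -
  have "cos (\<i> * of_real t * of_real L) = complex_of_real (cosh (t * L))"
    using cos_i_of_real[of "t * L"] by (simp add: mult.assoc)
  then show ?thesis unfolding eigval_def by (simp only: of_real_mult of_real_numeral)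
qed

lemma eigval_real: "eigval (of_real x) = of_real (2 * sqrt (real q) * cos (x * L))"
proof -
  have "cos (of_real x * of_real L) = complex_of_real (cos (x * L))"
    by (simp flip: cos_of_real)
  then show ?thesis unfolding eigval_def by (simp only: of_real_mult of_real_numeral)
qed

lemma eigval_shift: "eigval (of_real (pi / L) + \<i> * of_real t) = of_real (- (2 * sqrt (real q) * cosh (t * L)))"
proof -
  have "(of_real (pi / L) + \<i> * of_real t) * complex_of_real L = of_real pi + \<i> * of_real (t * L)"
    using L_pos by (simp add: distrib_right mult.assoc)
  moreover have "cos (of_real pi + \<i> * of_real (t * L)) = - complex_of_real (cosh (t * L))"
    by (simp only: cos_add cos_of_real sin_of_real cos_pi sin_pi cos_i_of_real) simp
  ultimately show ?thesis unfolding eigval_def by (simp only: of_real_mult of_real_numeral of_real_minus) simp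
qed

lemma spectral_set_cases [consumes 1, case_names imag real shift]:
  assumes "l \<in> spectral_set q"
  obtains t where "l = \<i> * of_real t" "0 \<le> t" "t \<le> 1/2"
        | x where "l = of_real x" "0 < x" "x < pi / L"
        | t where "l = of_real (pi / L) + \<i> * of_real t" "0 \<le> t" "t \<le> 1/2"
  using assms unfolding spectral_set_def by (auto simp del: of_real_divide)

lemma cosh_mono_inj: "0 \<le> s \<Longrightarrow> 0 \<le> t \<Longrightarrow> cosh (s * L) = cosh (t * L) \<Longrightarrow> s = t"
  using cosh_real_nonneg_less_iff[of "s * L" "t * L"] cosh_real_nonneg_less_iff[of "t * L" "s * L"] L_pos
  by (cases s t rule: linorder_cases) auto

lemma cos_strict_bounds: assumes "0 < x" "x < pi / L" shows "\<bar>cos (x * L)\<bar> < 1"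
proof -
  have x: "0 < x * L" "x * L < pi" using assms L_pos by (auto simp: field_simps)
  have "cos (x * L) < 1" using cos_monotone_0_pi[of 0 "x * L"] x by simp
  moreover have "cos (x * L) > -1" using cos_monotone_0_pi[of "x * L" pi] x by simp
  ultimately show ?thesis by simp
qed

text \<open>Divided by 2 sqrt q, the eigenvalue is cosh, cos or -cosh on the three pieces of the
  spectral set. The values are at least 1, strictly between -1 and 1, and at most -1, and each
  function is injective on its piece.\<close>

lemma eigval_inj: assumes "l \<in> spectral_set q" "l' \<in> spectral_set q" "eigval l = eigval l'" shows "l = l'"
proof -
  have sq: "2 * sqrt (real q) > 0" using q2 by simp
  define R where "R l = Re (eigval l) / (2 * sqrt (real q))" for l
  have RR: "R l = R l'" using assms(3) by (simp add: R_def)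
  have Ri: "R (\<i> * of_real t) = cosh (t * L)" for t using sq by (simp add: R_def eigval_imag)
  have Rr: "R (of_real x) = cos (x * L)" for x using sq by (simp add: R_def eigval_real)
  have Rs: "R (of_real (pi / L) + \<i> * of_real t) = - cosh (t * L)" for t
    unfolding R_def eigval_shift using sq by simp
  have c: "cosh (t * L) \<ge> 1" for t by (rule cosh_real_ge_1)
  show ?thesis
    using assms(1)
  proof (cases rule: spectral_set_cases)
    case (imag t)
    note 1 = this
    show ?thesis using assms(2)
    proof (cases rule: spectral_set_cases)
      case (imag s) then show ?thesis using 1 RR cosh_mono_inj[of t s] by (simp add: Ri)
    next
      case (real x) then show ?thesis using 1 RR c[of t] cos_strict_bounds[of x] by (simp add: Ri Rr)
    next
      case (shift s) then show ?thesis using RR c[of t] c[of s] unfolding 1(1) shift(1) Ri Rs by linarith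
    qed
  next
    case (real x)
    note 1 = this
    show ?thesis using assms(2)
    proof (cases rule: spectral_set_cases)
      case (imag s) then show ?thesis using 1 RR c[of s] cos_strict_bounds[of x] by (simp add: Ri Rr)
    next
      case (real y)
      have "x * L = y * L"
        by (rule cos_inj_pi) (use 1 real RR L_pos in \<open>auto simp: Rr field_simps\<close>)
      then show ?thesis using 1 real L_pos by simp
    next
      case (shift s) then show ?thesis using RR c[of s] cos_strict_bounds[of x] 1 unfolding 1(1) shift(1) Rr Rs by linarith
    qed
  next
    case (shift t)
    note 1 = this
    show ?thesis using assms(2)
    proof (cases rule: spectral_set_cases)
      case (imag s) then show ?thesis using RR c[of t] c[of s] unfolding 1(1) imag(1) Ri Rs by linarith
    next
      case (real x) then show ?thesis using RR c[of t] cos_strict_bounds[of x] unfolding 1(1) real(1) Rr Rs by linarith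
    next
      case (shift s)
      have "cosh (t * L) = cosh (s * L)" using RR unfolding 1(1) shift(1) Rs by simp
      then show ?thesis using 1 shift cosh_mono_inj[of t s] by simp
    qed
  qed
qed

lemma spectral_set_bounded: "spectral_set q \<subseteq> cball 0 (pi / L + 1)"
proof
  fix l assume "l \<in> spectral_set q"
  then show "l \<in> cball 0 (pi / L + 1)"
  proof (cases rule: spectral_set_cases)
    case (imag t)
    have "0 < pi / L" using L_pos by simp
    then have "t \<le> pi / L + 1" using imag by linarith
    then show ?thesis using imag by (simp add: norm_mult)
  next
    case (real x) then show ?thesis by simp
  next
    case (shift t)
    have "norm l \<le> norm (complex_of_real (pi / L)) + norm (\<i> * complex_of_real t)"
      unfolding shift(1) by (rule norm_triangle_ineq)
    also have "\<dots> = pi / L + t" using L_pos shift by (simp add: norm_mult norm_divide)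
    finally show ?thesis using shift by simp
  qed
qed

lemma continuous_sph: "continuous_on A (\<lambda>t::complex. sph n t)"
  by (induction n rule: induct_nat_012) (auto intro!: continuous_intros)

lemma continuous_transform: "continuous_on A (transform x f \<circ> eigval)"
proof -
  have "continuous_on A eigval" for A unfolding eigval_def by (intro continuous_intros)
  moreover have "continuous_on A (transform x f)" for A
    unfolding transform_def sphf_def by (intro continuous_intros continuous_sph) auto
  ultimately show ?thesis by (rule continuous_on_compose)
qed

lemma transform_integrable:
  assumes "sets \<sigma> = sets (restrict_space borel (spectral_set q))" "finite_measure \<sigma>"
  shows "integrable \<sigma> (\<lambda>l. (cmod (transform x f (eigval l)))\<^sup>2)"
proof -
  interpret finite_measure \<sigma> by fact
  let ?F = "\<lambda>l. (cmod (transform x f (eigval l)))\<^sup>2"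
  have cont: "continuous_on A ?F" for A
    using continuous_transform[of A x f] by (auto intro!: continuous_intros simp: comp_def)
  have "compact (?F ` cball 0 (pi / L + 1))"
    by (intro compact_continuous_image cont) simp
  then have "bounded (?F ` cball 0 (pi / L + 1))" by (rule compact_imp_bounded)
  then obtain B where "\<forall>y\<in>?F ` cball 0 (pi / L + 1). norm y \<le> B" unfolding bounded_iff by blast
  then have B: "norm (?F l) \<le> B" if "l \<in> cball 0 (pi / L + 1)" for l using that by blast
  show ?thesis
  proof (rule integrable_const_bound)
    have "space \<sigma> = spectral_set q"
      using sets_eq_imp_space_eq[OF assms(1)] by (simp add: space_restrict_space)
    then show "AE l in \<sigma>. norm (?F l) \<le> B" using B spectral_set_bounded by (intro AE_I2) blast
    have "?F \<in> borel_measurable (restrict_space borel (spectral_set q))"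
      by (rule borel_measurable_continuous_on_restrict) (rule cont)
    then show "?F \<in> borel_measurable \<sigma>" using measurable_cong_sets[OF assms(1) refl] by blast
  qed
qed

text \<open>Inverts \<open>eigval\<close> on two kinds of eigenvalues: q + 1 and -(q + 1), which go
  to the two points removed from the starred spectral set, and those of absolute value below 2 sqrt
  q, which go to the real segment.\<close>

definition loc :: "real \<Rightarrow> complex" where
  "loc \<theta> = (if \<theta> = real q + 1 then \<i> / 2 else if \<theta> = - (real q + 1) then of_real (pi / L) + \<i> / 2
     else of_real (arccos (\<theta> / (2 * sqrt (real q))) / L))"

lemma two_sqrt_less: "2 * sqrt (real q) < real q + 1"
proof -
  have "sqrt (real q) \<noteq> 1" using q2 by simp
  then have "(sqrt (real q) - 1)\<^sup>2 > 0" by simp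
  then show ?thesis using q2 by (simp add: power2_diff)
qed

lemma loc_facts:
  assumes "\<theta> = real q + 1 \<or> \<theta> = - (real q + 1) \<or> \<bar>\<theta>\<bar> < 2 * sqrt (real q)"
  shows "loc \<theta> \<in> spectral_set q" "eigval (loc \<theta>) = of_real \<theta>"
    "loc \<theta> \<in> spectral_set_star q \<longleftrightarrow> \<bar>\<theta>\<bar> < 2 * sqrt (real q)"
proof -
  have sq: "2 * sqrt (real q) > 0" using q2 by simp
  \<comment> \<open>At height 1/2 the argument is ln (sqrt q), so cosh is the mean of sqrt q and its
    reciprocal. This is what ties the two removed points to the eigenvalues q + 1 and -(q +
    1).\<close>
  have ch: "2 * sqrt (real q) * cosh ((1/2) * L) = real q + 1"
  proof -
    have "(1/2) * L = ln (sqrt (real q))" using q2 by (simp add: ln_sqrt)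
    then have "cosh ((1/2) * L) = (sqrt (real q) + inverse (sqrt (real q))) / 2" using q2 cosh_ln_real[of "sqrt (real q)"] by simp
    then show ?thesis using q2 by (simp add: field_simps)
  qed
  have half: "\<i> / 2 = \<i> * complex_of_real (1/2)" by simp
  have "loc \<theta> \<in> spectral_set q \<and> eigval (loc \<theta>) = of_real \<theta> \<and>
    (loc \<theta> \<in> spectral_set_star q \<longleftrightarrow> \<bar>\<theta>\<bar> < 2 * sqrt (real q))"
  proof (cases "\<bar>\<theta>\<bar> < 2 * sqrt (real q)")
    case False
    with assms consider "\<theta> = real q + 1" | "\<theta> = - (real q + 1)" by blast
    then show ?thesis
    proof cases
      case 1
      then have l: "loc \<theta> = \<i> / 2" by (simp add: loc_def)
      have "\<i> / 2 \<in> spectral_set q" unfolding spectral_set_def half by (rule UnI1, rule UnI1, rule imageI) simp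
      moreover have "eigval (\<i> / 2) = of_real \<theta>" unfolding half eigval_imag ch 1 by simp
      ultimately show ?thesis unfolding l using False by (simp add: spectral_set_star_def)
    next
      case 2
      then have l: "loc \<theta> = of_real (pi / L) + \<i> / 2" using q2 by (simp add: loc_def)
      have "of_real (pi / L) + \<i> / 2 \<in> spectral_set q"
        unfolding spectral_set_def half by (rule UnI2, rule imageI) simp
      moreover have "eigval (of_real (pi / L) + \<i> / 2) = of_real \<theta>"
        unfolding half eigval_shift ch 2 by simp
      ultimately show ?thesis unfolding l using False by (simp add: spectral_set_star_def)
    qed
  next
    case True
    then have l: "loc \<theta> = of_real (arccos (\<theta> / (2 * sqrt (real q))) / L)"
      using two_sqrt_less by (auto simp: loc_def)
    let ?y = "\<theta> / (2 * sqrt (real q))"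
    have y: "-1 < ?y" "?y < 1" using True sq by (auto simp: field_simps abs_less_iff)
    have a: "0 < arccos ?y" "arccos ?y < pi" using arccos_lt_bounded[OF y] by auto
    have ae: "arccos ?y / L * L = arccos ?y" using L_pos by simp
    have "loc \<theta> \<in> spectral_set q"
      unfolding l spectral_set_def using a L_pos
      by (intro UnI1 UnI2 imageI) (auto simp: divide_strict_right_mono)
    moreover have "eigval (loc \<theta>) = of_real \<theta>"
      unfolding l eigval_real ae using y sq by (simp add: cos_arccos)
    moreover have "loc \<theta> \<noteq> \<i> / 2" "loc \<theta> \<noteq> of_real (pi / L) + \<i> / 2"
      unfolding l by (auto simp: complex_eq_iff)
    ultimately show ?thesis using True by (simp add: spectral_set_star_def)
  qed
  then show "loc \<theta> \<in> spectral_set q" "eigval (loc \<theta>) = of_real \<theta>"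
    "loc \<theta> \<in> spectral_set_star q \<longleftrightarrow> \<bar>\<theta>\<bar> < 2 * sqrt (real q)" by blast+
qed

end

text \<open>The eigenfunction decomposition is data and not drawn from a spectral theorem: for each
  of the three graphs it is written down explicitly. \<open>S_range\<close> says that the
  eigenvalues occurring are those of a Ramanujan graph, with strict inequality, so that
  \<open>loc\<close> handles them all.\<close>

locale spectral_orbit = lattice_orbit q T V E \<pi> m x\<^sub>0
  for q and T :: "'v \<Rightarrow> 'v \<Rightarrow> bool" and V :: "'w set" and E \<pi> m x\<^sub>0 +
  fixes S :: "real set" and e :: "real \<Rightarrow> 'w \<Rightarrow> real"
  assumes finite_S: "finite S"
    and S_range: "\<theta> \<in> S \<Longrightarrow> \<theta> = real q + 1 \<or> \<theta> = - (real q + 1) \<or> \<bar>\<theta>\<bar> < 2 * sqrt (real q)"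
    and eigen: "\<theta> \<in> S \<Longrightarrow> v \<in> V \<Longrightarrow> (\<Sum>w | E v w. e \<theta> w) = \<theta> * e \<theta> v"
    and decomposition: "v \<in> V \<Longrightarrow> (\<Sum>\<theta>\<in>S. e \<theta> v) = of_bool (v = \<pi> x\<^sub>0)"
begin

definition weight where "weight \<theta> = (\<Sum>v\<in>V. (e \<theta> v)\<^sup>2) / card V"

lemma weight_nonneg: "0 \<le> weight \<theta>"
  by (simp add: weight_def sum_nonneg)

text \<open>Symmetry of \<open>E\<close> makes the adjacency operator self-adjoint; applying it to
  either factor gives \<theta> and \<theta>' times the same sum.\<close>

lemma orthogonal:
  assumes "\<theta> \<in> S" "\<theta>' \<in> S" "\<theta> \<noteq> \<theta>'"
  shows "(\<Sum>v\<in>V. e \<theta> v * e \<theta>' v) = 0"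
proof -
  have nb: "(\<Sum>w | E v w. f w) = (\<Sum>w\<in>V. if E v w then f w else 0)" if "v \<in> V" for v and f :: "_ \<Rightarrow> real"
  proof -
    have "{w. E v w} = {w\<in>V. E v w}" using E_in_V[OF that] by blast
    then show ?thesis using finite_V by (simp add: sum.inter_filter)
  qed
  have "\<theta> * (\<Sum>v\<in>V. e \<theta> v * e \<theta>' v) = (\<Sum>v\<in>V. (\<theta> * e \<theta> v) * e \<theta>' v)"
    by (simp add: sum_distrib_left mult.assoc)
  also have "\<dots> = (\<Sum>v\<in>V. (\<Sum>w\<in>V. if E v w then e \<theta> w else 0) * e \<theta>' v)"
    using eigen[OF assms(1)] nb by (intro sum.cong refl) simp
  also have "\<dots> = (\<Sum>v\<in>V. \<Sum>w\<in>V. if E v w then e \<theta> w * e \<theta>' v else 0)"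
    unfolding sum_distrib_right by (intro sum.cong refl) simp
  also have "\<dots> = (\<Sum>w\<in>V. \<Sum>v\<in>V. if E v w then e \<theta> w * e \<theta>' v else 0)"
    by (rule sum.swap)
  also have "\<dots> = (\<Sum>w\<in>V. e \<theta> w * (\<Sum>v\<in>V. if E w v then e \<theta>' v else 0))"
    unfolding sum_distrib_left by (intro sum.cong refl) (use E_sym in auto)
  also have "\<dots> = (\<Sum>w\<in>V. e \<theta> w * (\<theta>' * e \<theta>' w))"
    using eigen[OF assms(2)] nb by (intro sum.cong refl) simp
  also have "\<dots> = \<theta>' * (\<Sum>v\<in>V. e \<theta> v * e \<theta>' v)"
    by (simp add: sum_distrib_left mult_ac)
  finally show ?thesis using assms(3) by simp
qed

lemma linear_statistic_orbit:
  assumes "C \<in> cosets" "radial T x\<^sub>0 f" "finite {y. f y \<noteq> 0}"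
  shows "linear_statistic f (\<lambda>y. of_bool (label C y = \<pi> x\<^sub>0)) =
    (\<Sum>\<theta>\<in>S. transform x\<^sub>0 f (of_real \<theta>) * of_real (e \<theta> (label C x\<^sub>0)))"
proof -
  have "complex_of_real (of_bool (label C y = \<pi> x\<^sub>0)) * f y = (\<Sum>\<theta>\<in>S. f y * of_real (e \<theta> (label C y)))"
    for y
    unfolding decomposition[OF label_in, symmetric] of_real_sum sum_distrib_right by (simp add: mult.commute)
  then have "linear_statistic f (\<lambda>y. of_bool (label C y = \<pi> x\<^sub>0)) =
      (\<Sum>y | f y \<noteq> 0. \<Sum>\<theta>\<in>S. f y * of_real (e \<theta> (label C y)))"
    unfolding linear_statistic_def by simp
  also have "\<dots> = (\<Sum>\<theta>\<in>S. \<Sum>y | f y \<noteq> 0. f y * of_real (e \<theta> (label C y)))"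
    by (rule sum.swap)
  also have "\<dots> = (\<Sum>\<theta>\<in>S. transform x\<^sub>0 f (of_real \<theta>) * of_real (e \<theta> (label C x\<^sub>0)))"
  proof (intro sum.cong refl radial_sum_eigen assms)
    fix \<theta> z assume "\<theta> \<in> S"
    have "(\<Sum>y | T z y. complex_of_real (e \<theta> (label C y))) = of_real (\<Sum>w | E (label C z) w. e \<theta> w)"
      using sum_label_nbrs[OF assms(1), of "e \<theta>" z] by (metis of_real_sum)
    then show "(\<Sum>y | T z y. complex_of_real (e \<theta> (label C y))) = of_real \<theta> * of_real (e \<theta> (label C z))"
      using eigen[OF \<open>\<theta> \<in> S\<close>, of "label C z"] by simp
  qed
  finally show ?thesis .
qed

lemma correlation:
  assumes f: "radial T x\<^sub>0 f" "finite {y. f y \<noteq> 0}" and g: "radial T x\<^sub>0 g" "finite {y. g y \<noteq> 0}"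
  shows "(\<integral>p. linear_statistic f p * cnj (linear_statistic g p) \<partial>random_lattice_orbit T x\<^sub>0 m) =
    (\<Sum>\<theta>\<in>S. of_real (weight \<theta>) * (transform x\<^sub>0 f (of_real \<theta>) * cnj (transform x\<^sub>0 g (of_real \<theta>))))"
proof -
  let ?a = "\<lambda>\<theta>. transform x\<^sub>0 f (of_real \<theta>)" and ?b = "\<lambda>\<theta>. cnj (transform x\<^sub>0 g (of_real \<theta>))"
  let ?\<phi> = "\<lambda>v. (\<Sum>\<theta>\<in>S. ?a \<theta> * of_real (e \<theta> v)) * (\<Sum>\<theta>\<in>S. ?b \<theta> * of_real (e \<theta> v))"
  have "cnj \<in> borel_measurable borel" by (intro borel_measurable_continuous_onI continuous_intros)
  then have "(\<lambda>p. linear_statistic f p * cnj (linear_statistic g p)) \<in> borel_measurable configurations"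
    using linear_statistic_measurable[of f] linear_statistic_measurable[of g]
    by (intro borel_measurable_times) (auto intro: measurable_compose)
  then have "(\<integral>p. linear_statistic f p * cnj (linear_statistic g p) \<partial>random_lattice_orbit T x\<^sub>0 m) =
    (\<integral>C. linear_statistic f (\<lambda>y. of_bool (label C y = \<pi> x\<^sub>0)) *
       cnj (linear_statistic g (\<lambda>y. of_bool (label C y = \<pi> x\<^sub>0))) \<partial>m)"
    by (rule integral_random_lattice_orbit)
  also have "\<dots> = (\<integral>C. ?\<phi> (label C x\<^sub>0) \<partial>m)"
    by (intro Bochner_Integration.integral_cong refl)
       (simp add: space_m linear_statistic_orbit f g)
  also have "\<dots> = (\<Sum>v\<in>V. ?\<phi> v) / card V" by (rule expectation_label_uniform)
  also have "(\<Sum>v\<in>V. ?\<phi> v) = (\<Sum>v\<in>V. \<Sum>\<theta>\<in>S. \<Sum>\<theta>'\<in>S. ?a \<theta> * ?b \<theta>' * of_real (e \<theta> v * e \<theta>' v))"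
    by (intro sum.cong refl) (simp add: sum_product mult_ac)
  also have "\<dots> = (\<Sum>\<theta>\<in>S. \<Sum>\<theta>'\<in>S. \<Sum>v\<in>V. ?a \<theta> * ?b \<theta>' * of_real (e \<theta> v * e \<theta>' v))"
    by (subst sum.swap, rule sum.cong[OF refl], rule sum.swap)
  also have "\<dots> = (\<Sum>\<theta>\<in>S. \<Sum>\<theta>'\<in>S. ?a \<theta> * ?b \<theta>' * of_real (\<Sum>v\<in>V. e \<theta> v * e \<theta>' v))"
    by (simp add: sum_distrib_left)
  also have "\<dots> = (\<Sum>\<theta>\<in>S. \<Sum>\<theta>'\<in>S. if \<theta>' = \<theta> then ?a \<theta> * ?b \<theta> * of_real (\<Sum>v\<in>V. (e \<theta> v)\<^sup>2) else 0)"
    by (intro sum.cong refl) (use orthogonal in \<open>auto simp: power2_eq_square simp del: of_real_sum\<close>)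
  also have "\<dots> = (\<Sum>\<theta>\<in>S. ?a \<theta> * ?b \<theta> * of_real (\<Sum>v\<in>V. (e \<theta> v)\<^sup>2))"
    using finite_S by simp
  finally show ?thesis by (simp add: weight_def sum_divide_distrib[of _ S] mult_ac)
qed

section \<open>Existence and uniqueness of the atomic diffraction measure\<close>

definition atoms :: "complex measure" where
  "atoms = distr (point_measure S (\<lambda>\<theta>. ennreal (weight \<theta>))) (restrict_space borel (spectral_set q)) loc"

lemma loc_measurable:
  "loc \<in> measurable (point_measure S (\<lambda>\<theta>. ennreal (weight \<theta>))) (restrict_space borel (spectral_set q))"
  using loc_facts(1)[OF S_range] by (auto simp: space_restrict_space)

lemma sets_atoms: "sets atoms = sets (restrict_space borel (spectral_set q))"
  by (simp add: atoms_def)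

lemma finite_atoms: "finite_measure atoms"
proof
  have top: "spectral_set q \<in> sets (restrict_space borel (spectral_set q))"
    using sets.top[of "restrict_space borel (spectral_set q)"] by (simp add: space_restrict_space)
  have "emeasure atoms (space atoms) = (\<Sum>\<theta>\<in>S. ennreal (weight \<theta>))"
    unfolding atoms_def
    by (subst emeasure_distr[OF loc_measurable])
       (auto simp: top loc_facts(1)[OF S_range] space_restrict_space space_point_measure
        emeasure_point_measure_finite finite_S vimage_def Int_def conj_commute intro!: sum.cong cong: conj_cong)
  also have "\<dots> < top_class.top" using finite_S by (simp add: ennreal_sum_less_top)
  finally show "emeasure atoms (space atoms) \<noteq> \<infinity>" by simp
qed

lemma integral_atoms:
  fixes F :: "complex \<Rightarrow> 'b::{banach, second_countable_topology}"
  assumes "F \<in> borel_measurable (restrict_space borel (spectral_set q))"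
  shows "(\<integral>l. F l \<partial>atoms) = (\<Sum>\<theta>\<in>S. weight \<theta> *\<^sub>R F (loc \<theta>))"
  unfolding atoms_def integral_distr[OF loc_measurable assms]
  by (rule lebesgue_integral_point_measure_finite) (auto simp: finite_S weight_nonneg)

text \<open>The property under the definite description in \<open>diffraction_measure\<close>, named
  so that an arbitrary candidate can be compared with \<open>atoms\<close>.\<close>

definition is_diffraction where
  "is_diffraction \<sigma> \<longleftrightarrow> sets \<sigma> = sets (restrict_space borel (spectral_set q)) \<and> finite_measure \<sigma> \<and>
        (\<forall>f\<^sub>1 f\<^sub>2. finite {x. f\<^sub>1 x \<noteq> 0} \<and> radial T x\<^sub>0 f\<^sub>1 \<and> finite {x. f\<^sub>2 x \<noteq> 0} \<and> radial T x\<^sub>0 f\<^sub>2 \<longrightarrow>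
           (\<integral>p. linear_statistic f\<^sub>1 p * cnj (linear_statistic f\<^sub>2 p) \<partial>random_lattice_orbit T x\<^sub>0 m) =
           (\<integral>l. spherical_transform q T x\<^sub>0 f\<^sub>1 l * cnj (spherical_transform q T x\<^sub>0 f\<^sub>2 l) \<partial>\<sigma>))"

lemma atoms_is_diffraction: "is_diffraction atoms"
proof -
  have "(\<integral>l. transform x\<^sub>0 f (eigval l) * cnj (transform x\<^sub>0 g (eigval l)) \<partial>atoms) =
    (\<Sum>\<theta>\<in>S. of_real (weight \<theta>) * (transform x\<^sub>0 f (of_real \<theta>) * cnj (transform x\<^sub>0 g (of_real \<theta>))))" for f g
  proof -
    have "(\<lambda>l. transform x\<^sub>0 f (eigval l) * cnj (transform x\<^sub>0 g (eigval l)))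
        \<in> borel_measurable (restrict_space borel (spectral_set q))"
      by (rule borel_measurable_continuous_on_restrict)
         (use continuous_transform[of _ x\<^sub>0] in \<open>auto intro!: continuous_intros simp: comp_def\<close>)
    then show ?thesis
      by (subst integral_atoms) (auto simp: loc_facts(2)[OF S_range] scaleR_conv_of_real intro!: sum.cong)
  qed
  then show ?thesis
    unfolding is_diffraction_def spherical_transform_eq
    using sets_atoms finite_atoms correlation by simp
qed

text \<open>Using one test function twice makes the integrand nonnegative, so that a vanishing
  integral has consequences almost everywhere.\<close>

lemma diffraction_square:
  assumes "is_diffraction \<sigma>" "radial T x\<^sub>0 f" "finite {y. f y \<noteq> 0}"
  shows "(\<integral>l. (cmod (transform x\<^sub>0 f (eigval l)))\<^sup>2 \<partial>\<sigma>) =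
     (\<Sum>\<theta>\<in>S. weight \<theta> * (cmod (transform x\<^sub>0 f (of_real \<theta>)))\<^sup>2)"
proof -
  have "complex_of_real (\<integral>l. (cmod (transform x\<^sub>0 f (eigval l)))\<^sup>2 \<partial>\<sigma>) =
      (\<integral>l. transform x\<^sub>0 f (eigval l) * cnj (transform x\<^sub>0 f (eigval l)) \<partial>\<sigma>)"
    unfolding integral_complex_of_real[symmetric] complex_norm_square ..
  also have "\<dots> = (\<integral>p. linear_statistic f p * cnj (linear_statistic f p) \<partial>random_lattice_orbit T x\<^sub>0 m)"
    using assms(1)[unfolded is_diffraction_def spherical_transform_eq, THEN conjunct2, THEN conjunct2,
        rule_format, of f f] assms(2,3) by simp
  also have "\<dots> = (\<Sum>\<theta>\<in>S. of_real (weight \<theta>) *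
      (transform x\<^sub>0 f (of_real \<theta>) * cnj (transform x\<^sub>0 f (of_real \<theta>))))"
    by (rule correlation[OF assms(2,3) assms(2,3)])
  also have "\<dots> = complex_of_real (\<Sum>\<theta>\<in>S. weight \<theta> * (cmod (transform x\<^sub>0 f (of_real \<theta>)))\<^sup>2)"
    unfolding complex_norm_square[symmetric] by simp
  finally show ?thesis by (simp only: of_real_eq_iff)
qed

text \<open>A test function whose transform vanishes on all of \<open>S\<close> has square integral
  zero, so almost every point has its eigenvalue in \<open>S\<close>. Injectivity of
  \<open>eigval\<close> identifies that point as \<open>loc \<theta>\<close>.\<close>

lemma AE_diffraction: assumes "is_diffraction \<sigma>" shows "AE l in \<sigma>. l \<in> loc ` S"
proof -
  have \<sigma>: "sets \<sigma> = sets (restrict_space borel (spectral_set q))" "finite_measure \<sigma>"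
    using assms by (auto simp: is_diffraction_def)
  have sp: "space \<sigma> = spectral_set q"
    using sets_eq_imp_space_eq[OF \<sigma>(1)] by (simp add: space_restrict_space)
  obtain f where f: "radial T x\<^sub>0 f" "finite {y. f y \<noteq> 0}"
    "\<And>t. transform x\<^sub>0 f t = (\<Prod>a\<in>of_real ` S. t - a)"
    using transform_surj[of "of_real ` S" x\<^sub>0] finite_S by blast
  have "transform x\<^sub>0 f (of_real \<theta>) = 0" if "\<theta> \<in> S" for \<theta>
    using that finite_S by (auto simp: f(3))
  then have "(\<integral>l. (cmod (transform x\<^sub>0 f (eigval l)))\<^sup>2 \<partial>\<sigma>) = 0"
    using diffraction_square[OF assms f(1,2)] by simp
  then have "AE l in \<sigma>. (cmod (transform x\<^sub>0 f (eigval l)))\<^sup>2 = 0"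
    using integral_nonneg_eq_0_iff_AE[OF transform_integrable[OF \<sigma>]] by simp
  then show ?thesis
  proof (rule AE_mp, intro AE_I2 impI)
    fix l assume l: "l \<in> space \<sigma>" "(cmod (transform x\<^sub>0 f (eigval l)))\<^sup>2 = 0"
    then obtain \<theta> where \<theta>: "\<theta> \<in> S" "eigval l = of_real \<theta>" using finite_S by (auto simp: f(3))
    then have "l = loc \<theta>" using eigval_inj[of l "loc \<theta>"] loc_facts[OF S_range[OF \<theta>(1)]] l(1) sp by simp
    then show "l \<in> loc ` S" using \<theta>(1) by simp
  qed
qed

lemma sing_in_sets:
  assumes "is_diffraction \<sigma>" "\<theta> \<in> S" shows "{loc \<theta>} \<in> sets \<sigma>"
proof -
  have "sets \<sigma> = sets (restrict_space borel (spectral_set q))" using assms by (simp add: is_diffraction_def)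
  moreover have "{loc \<theta>} = spectral_set q \<inter> {loc \<theta>}" using loc_facts(1)[OF S_range[OF assms(2)]] by auto
  then have "{loc \<theta>} \<in> sets (restrict_space borel (spectral_set q))"
    unfolding sets_restrict_space by (rule image_eqI) simp
  ultimately show ?thesis by simp
qed

text \<open>A transform with zeros at all of \<open>S\<close> except \<theta> isolates one atom in
  the integral and one term in the spectral sum, with the same nonzero factor.\<close>

lemma measure_diffraction_atom:
  assumes "is_diffraction \<sigma>" "\<theta> \<in> S"
  shows "measure \<sigma> {loc \<theta>} = weight \<theta>"
proof -
  have \<sigma>: "sets \<sigma> = sets (restrict_space borel (spectral_set q))" "finite_measure \<sigma>"
    using assms by (auto simp: is_diffraction_def)
  interpret finite_measure \<sigma> by fact
  obtain f where f: "radial T x\<^sub>0 f" "finite {y. f y \<noteq> 0}"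
    "\<And>t. transform x\<^sub>0 f t = (\<Prod>a\<in>of_real ` (S - {\<theta>}). t - a)"
    using transform_surj[of "of_real ` (S - {\<theta>})" x\<^sub>0] finite_S by blast
  let ?F = "\<lambda>t. (cmod (transform x\<^sub>0 f t))\<^sup>2"
  have zero: "?F (of_real \<theta>') = 0" if "\<theta>' \<in> S" "\<theta>' \<noteq> \<theta>" for \<theta>'
    using that finite_S by (auto simp: f(3))
  have nonzero: "?F (of_real \<theta>) \<noteq> 0" using finite_S by (auto simp: f(3))
  have "(\<integral>l. ?F (eigval l) \<partial>\<sigma>) = (\<integral>l. indicator {loc \<theta>} l * ?F (of_real \<theta>) \<partial>\<sigma>)"
  proof (rule integral_cong_AE)
    show "(\<lambda>l. ?F (eigval l)) \<in> borel_measurable \<sigma>" using transform_integrable[OF \<sigma>] by blast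
    show "(\<lambda>l. indicator {loc \<theta>} l * ?F (of_real \<theta>)) \<in> borel_measurable \<sigma>"
      using sing_in_sets[OF assms] by measurable
    show "AE l in \<sigma>. ?F (eigval l) = indicator {loc \<theta>} l * ?F (of_real \<theta>)"
      using AE_diffraction[OF assms(1)]
    proof (rule AE_mp, intro AE_I2 impI)
      fix l assume "l \<in> loc ` S"
      then obtain \<theta>' where \<theta>': "\<theta>' \<in> S" "l = loc \<theta>'" by blast
      have ev: "eigval l = of_real \<theta>'" using loc_facts(2)[OF S_range[OF \<theta>'(1)]] \<theta>'(2) by simp
      show "?F (eigval l) = indicator {loc \<theta>} l * ?F (of_real \<theta>)"
      proof (cases "\<theta>' = \<theta>")
        case False
        then have "l \<noteq> loc \<theta>" using ev loc_facts(2)[OF S_range[OF assms(2)]] by auto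
        then show ?thesis using ev zero[OF \<theta>'(1) False] by simp
      qed (use ev \<theta>' in simp)
    qed
  qed
  also have "\<dots> = measure \<sigma> {loc \<theta>} * ?F (of_real \<theta>)"
    using sing_in_sets[OF assms] by (simp add: sets.Int_space_eq2)
  finally have "measure \<sigma> {loc \<theta>} * ?F (of_real \<theta>) = (\<Sum>\<theta>'\<in>S. weight \<theta>' * ?F (of_real \<theta>'))"
    using diffraction_square[OF assms(1) f(1,2)] by simp
  also have "\<dots> = (\<Sum>\<theta>'\<in>S. if \<theta>' = \<theta> then weight \<theta> * ?F (of_real \<theta>) else 0)"
    by (intro sum.cong refl) (use zero in auto)
  also have "\<dots> = weight \<theta> * ?F (of_real \<theta>)" using finite_S assms(2) by simp
  finally show ?thesis using nonzero by simp
qed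

text \<open>The right side does not mention \<sigma>, so using this for a candidate and for
  \<open>atoms\<close> itself shows that they agree.\<close>

lemma measure_diffraction:
  assumes "is_diffraction \<sigma>" "A \<in> sets \<sigma>"
  shows "measure \<sigma> A = (\<Sum>l\<in>A \<inter> loc ` S. measure atoms {l})"
proof -
  interpret finite_measure \<sigma> using assms by (simp add: is_diffraction_def)
  have fin: "finite (A \<inter> loc ` S)" using finite_S by simp
  have sing: "{l} \<in> sets \<sigma>" if "l \<in> A \<inter> loc ` S" for l using sing_in_sets[OF assms(1)] that by auto
  have "(\<Union>l\<in>A \<inter> loc ` S. {l}) \<in> sets \<sigma>" by (rule sets.finite_UN[OF fin sing])
  then have "measure \<sigma> A = measure \<sigma> (A \<inter> loc ` S)"
    using AE_diffraction[OF assms(1)] assms(2) by (intro finite_measure_eq_AE) auto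
  also have "\<dots> = (\<Sum>l\<in>A \<inter> loc ` S. measure \<sigma> {l})" by (rule finite_measure_eq_sum_singleton[OF fin sing])
  also have "\<dots> = (\<Sum>l\<in>A \<inter> loc ` S. measure atoms {l})"
    using measure_diffraction_atom[OF assms(1)] measure_diffraction_atom[OF atoms_is_diffraction]
    by (intro sum.cong refl) auto
  finally show ?thesis .
qed

lemma diffraction_measure_eq: "diffraction_measure q T x\<^sub>0 (random_lattice_orbit T x\<^sub>0 m) = atoms"
  unfolding diffraction_measure_def is_diffraction_def[symmetric]
proof (rule the_equality[of is_diffraction, OF atoms_is_diffraction])
  fix \<sigma> assume \<sigma>: "is_diffraction \<sigma>"
  have sets: "sets \<sigma> = sets atoms" using \<sigma> atoms_is_diffraction by (simp add: is_diffraction_def)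
  show "\<sigma> = atoms"
  proof (rule measure_eqI[OF sets])
    fix A assume A: "A \<in> sets \<sigma>"
    interpret a: finite_measure \<sigma> using \<sigma> by (simp add: is_diffraction_def)
    interpret b: finite_measure atoms by (rule finite_atoms)
    show "emeasure \<sigma> A = emeasure atoms A"
      using measure_diffraction[OF \<sigma> A] measure_diffraction[OF atoms_is_diffraction, of A] A sets
      by (simp add: a.emeasure_eq_measure b.emeasure_eq_measure)
  qed
qed

lemma sph_of_real: "sph n (of_real \<theta>) = complex_of_real (sph n \<theta>)"
  by (induction n rule: induct_nat_012) auto

theorem sub_osc_number_variance_eq:
  "sub_osc_number_variance q T x\<^sub>0 (random_lattice_orbit T x\<^sub>0 m) r =
    (\<Sum>\<theta> | \<theta> \<in> S \<and> \<bar>\<theta>\<bar> < 2 * sqrt (real q). weight \<theta> * (\<Sum>n\<le>r. sph n \<theta>)\<^sup>2)"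
proof -
  let ?f = "indicator (graph_ball T x\<^sub>0 r) :: 'v \<Rightarrow> complex"
  let ?F = "\<lambda>l. indicator (spectral_set_star q) l *\<^sub>R (cmod (transform x\<^sub>0 ?f (eigval l)))\<^sup>2"
  have star: "spectral_set_star q = spectral_set q \<inter> (- {\<i> / 2, of_real (pi / L) + \<i> / 2})"
    by (auto simp: spectral_set_star_def)
  have "spectral_set_star q \<in> sets (restrict_space borel (spectral_set q))"
    unfolding star sets_restrict_space by (rule imageI) simp
  moreover have "(\<lambda>l. (cmod (transform x\<^sub>0 ?f (eigval l)))\<^sup>2) \<in>
      borel_measurable (restrict_space borel (spectral_set q))"
    by (rule borel_measurable_continuous_on_restrict)
         (use continuous_transform[of _ x\<^sub>0] in \<open>auto intro!: continuous_intros simp: comp_def\<close>)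
  ultimately have "?F \<in> borel_measurable (restrict_space borel (spectral_set q))"
    by (intro borel_measurable_scaleR borel_measurable_indicator)
  then have "(\<integral>l. ?F l \<partial>atoms) = (\<Sum>\<theta>\<in>S. weight \<theta> *\<^sub>R ?F (loc \<theta>))"
    by (rule integral_atoms)
  also have "\<dots> = (\<Sum>\<theta>\<in>S. if \<bar>\<theta>\<bar> < 2 * sqrt (real q) then weight \<theta> * (\<Sum>n\<le>r. sph n \<theta>)\<^sup>2 else 0)"
  proof (intro sum.cong refl)
    fix \<theta> assume "\<theta> \<in> S"
    note l = loc_facts[OF S_range[OF this]]
    have "cmod (transform x\<^sub>0 ?f (eigval (loc \<theta>))) = \<bar>\<Sum>n\<le>r. sph n \<theta>\<bar>"
      unfolding l(2) transform_ball sph_of_real of_real_sum[symmetric] by (rule norm_of_real)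
    then show "weight \<theta> *\<^sub>R ?F (loc \<theta>) = (if \<bar>\<theta>\<bar> < 2 * sqrt (real q) then weight \<theta> * (\<Sum>n\<le>r. sph n \<theta>)\<^sup>2 else 0)"
      using l(3) by simp
  qed
  also have "\<dots> = (\<Sum>\<theta> | \<theta> \<in> S \<and> \<bar>\<theta>\<bar> < 2 * sqrt (real q). weight \<theta> * (\<Sum>n\<le>r. sph n \<theta>)\<^sup>2)"
    by (rule sum.inter_filter[OF finite_S, symmetric])
  finally show ?thesis
    unfolding sub_osc_number_variance_def diffraction_measure_eq set_lebesgue_integral_def
      spherical_transform_eq .
qed

end

subsection \<open>Asymptotics of the number variance\<close>

text \<open>Dirichlet approximation brings all multiples close to integer multiples of pi, and
  shifting by those only changes the sign of the sine. The angles are scaled by \<open>Suc N\<close>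
  beforehand, so that even the multiplier 1 gives an index beyond \<open>N\<close>.\<close>

lemma sin_multiples_small:
  fixes \<phi> :: "'a \<Rightarrow> real"
  assumes "finite A" "\<epsilon> > 0"
  shows "\<exists>n\<ge>N. \<forall>a\<in>A. \<bar>sin (real n * \<phi> a)\<bar> < \<epsilon>"
proof -
  obtain h k where hk: "bij_betw h {..<k::nat} A"
    using assms(1) by (metis atLeast0LessThan bij_betw_from_nat_into_finite)
  \<comment> \<open>The approximation error 1 / M gets multiplied by pi, and pi / M must stay below
    \<epsilon>.\<close>
  obtain M :: nat where M: "pi / \<epsilon> < M" using reals_Archimedean2 by blast
  then have "M > 0" using assms(2) pi_gt_zero
    by (metis divide_pos_pos gr0I less_asym of_nat_0)
  then obtain d p where d: "0 < (d::int)"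
    "\<And>i. i < k \<Longrightarrow> \<bar>of_int d * (real (Suc N) * \<phi> (h i) / pi) - of_int (p i)\<bar> < 1 / M"
    using Dirichlet_approx_simult[where N = M and n = k and \<theta> = "\<lambda>i. real (Suc N) * \<phi> (h i) / pi"] by metis
  define n where "n = nat d * Suc N"
  have "n \<ge> N" using d(1) unfolding n_def by (cases "nat d") auto
  moreover have "\<bar>sin (real n * \<phi> a)\<bar> < \<epsilon>" if "a \<in> A" for a
  proof -
    obtain i where i: "i < k" "a = h i" using hk \<open>a \<in> A\<close> by (auto simp: bij_betw_def)
    let ?x = "real n * \<phi> a - of_int (p i) * pi"
    have n: "real n = of_int d * real (Suc N)" using d(1) by (simp add: n_def distrib_left)
    have "?x = pi * (of_int d * (real (Suc N) * \<phi> (h i) / pi) - of_int (p i))"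
      unfolding i(2) n by (simp add: right_diff_distrib)
    then have "\<bar>?x\<bar> = pi * \<bar>of_int d * (real (Suc N) * \<phi> (h i) / pi) - of_int (p i)\<bar>"
      by (simp add: abs_mult)
    also have "\<dots> < pi * (1 / M)" by (rule mult_strict_left_mono[OF d(2)[OF i(1)]]) simp
    also have "\<dots> < \<epsilon>" using M \<open>M > 0\<close> assms(2) by (simp add: field_simps)
    finally have "\<bar>?x\<bar> < \<epsilon>" .
    moreover have "\<bar>sin (real n * \<phi> a)\<bar> = \<bar>sin ?x\<bar>"
    proof -
      have s: "sin (of_int (p i) * pi) = 0" unfolding sin_zero_iff_int2 by blast
      have "\<bar>cos (of_int (p i) * pi)\<bar> = 1"
        using cos_squared_eq[of "of_int (p i) * pi"] unfolding s by (simp add: abs_square_eq_1)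
      with s show ?thesis by (simp add: sin_diff abs_mult)
    qed
    ultimately show ?thesis using abs_sin_x_le_abs_x[of ?x] by linarith
  qed
  ultimately show ?thesis by blast
qed

context tree
begin

section \<open>Ball sums, their recurrence and the volume of balls\<close>

definition ball_sum :: "nat \<Rightarrow> real \<Rightarrow> real" where
  "ball_sum r \<theta> = (\<Sum>n\<le>r. sph n \<theta>)"

lemma ball_sum_0: "ball_sum 0 \<theta> = 1" and ball_sum_1: "ball_sum (Suc 0) \<theta> = 1 + \<theta>"
  by (simp_all add: ball_sum_def)

text \<open>Summation removes the exceptional coefficient: in the ball of radius 2 the extra 1 of q
  + 1 cancels the 1 from the centre. The recurrence thus has constant coefficients from the
  start.\<close>

lemma ball_sum_rec: "ball_sum (Suc (Suc r)) \<theta> = \<theta> * ball_sum (Suc r) \<theta> - real q * ball_sum r \<theta>"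
proof (induction r)
  case 0 show ?case by (simp add: ball_sum_def algebra_simps)
next
  case (Suc r)
  have "ball_sum (Suc (Suc (Suc r))) \<theta> = ball_sum (Suc (Suc r)) \<theta> + sph (Suc (Suc (Suc r))) \<theta>"
    by (simp add: ball_sum_def del: sph.simps)
  also have "\<dots> = (\<theta> * ball_sum (Suc r) \<theta> - real q * ball_sum r \<theta>) +
     (\<theta> * sph (Suc (Suc r)) \<theta> - real q * sph (Suc r) \<theta>)"
    using Suc by simp
  also have "\<dots> = \<theta> * (ball_sum (Suc r) \<theta> + sph (Suc (Suc r)) \<theta>) - real q * (ball_sum r \<theta> + sph (Suc r) \<theta>)"
    by (simp only: distrib_left)
  also have "\<dots> = \<theta> * ball_sum (Suc (Suc r)) \<theta> - real q * ball_sum (Suc r) \<theta>"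
    by (simp add: ball_sum_def del: sph.simps)
  finally show ?case .
qed

lemma card_ball: "card (graph_ball T x r) = (\<Sum>n\<le>r. card (sphere x n))"
  unfolding graph_ball_eq by (rule card_UN_disjoint) auto

lemma card_ball_lower: "real q ^ r \<le> card (graph_ball T x r)"
proof -
  have "q ^ r \<le> card (sphere x r)" by (cases r) (auto simp: card_sphere)
  also have "\<dots> \<le> card (graph_ball T x r)"
    by (rule card_mono) (auto simp: graph_ball_eq)
  finally show ?thesis using of_nat_mono by fastforce
qed

lemma card_ball_upper: "card (graph_ball T x r) \<le> 3 * real q ^ r"
proof (induction r)
  case 0 show ?case by (simp add: card_ball)
next
  case (Suc r)
  have "real (card (graph_ball T x (Suc r))) = card (graph_ball T x r) + (real q + 1) * real q ^ r"
    by (simp add: card_ball card_sphere algebra_simps)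
  also have "\<dots> \<le> (real q + 4) * real q ^ r" using Suc by (simp add: algebra_simps)
  \<comment> \<open>The constant 3 reproduces itself because q + 4 \<le> 3 q, that is, q \<ge>
    2.\<close>
  also have "\<dots> \<le> (3 * real q) * real q ^ r" using q2 by (intro mult_right_mono) auto
  finally show ?case by (simp add: mult.assoc)
qed

lemma card_ball_pos: "0 < real (card (graph_ball T x r))"
proof -
  have "0 < real q ^ r" using q2 by simp
  then show ?thesis using card_ball_lower[of r x] by linarith
qed

text \<open>With \<theta> = 2 sqrt q cos \<phi> the sequence (sqrt q)^n sin (n \<phi>) solves the
  same recurrence and also starts at zero, so the value at n = 1 fixes the proportion. The factor
  sin \<phi> * sqrt q stands on the left to avoid dividing.\<close>

lemma ball_sum_oscillates:
  assumes \<theta>: "\<bar>\<theta>\<bar> < 2 * sqrt q" and zero: "ball_sum k \<theta> = 0"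
  defines "\<phi> \<equiv> arccos (\<theta> / (2 * sqrt q))"
  shows "ball_sum (k + n) \<theta> * (sin \<phi> * sqrt q) = ball_sum (Suc k) \<theta> * (sqrt q ^ n * sin (real n * \<phi>))"
proof (induction n rule: induct_nat_012)
  case 0 show ?case using zero by simp
next
  case 1 show ?case by simp
next
  case (ge2 n)
  have sq: "sqrt q > 0" "sqrt q * sqrt q = q" using q2 by auto
  have "\<theta> / (2 * sqrt q) \<ge> -1" "\<theta> / (2 * sqrt q) \<le> 1" using \<theta> sq by (auto simp: field_simps abs_less_iff)
  then have "cos \<phi> = \<theta> / (2 * sqrt q)" unfolding \<phi>_def by (rule cos_arccos)
  then have th: "\<theta> = 2 * sqrt q * cos \<phi>" using sq by simp
  have trig: "2 * cos \<phi> * sin (real (Suc n) * \<phi>) - sin (real n * \<phi>) = sin (real (Suc (Suc n)) * \<phi>)"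
  proof -
    have "sin (real (Suc (Suc n)) * \<phi>) = sin (real (Suc n) * \<phi> + \<phi>)"
      "sin (real n * \<phi>) = sin (real (Suc n) * \<phi> - \<phi>)" by (simp_all add: algebra_simps)
    then show ?thesis by (simp only: sin_add sin_diff) simp
  qed
  let ?s = "sin \<phi> * sqrt q" and ?b = "ball_sum (Suc k) \<theta>"
  have "ball_sum (k + Suc (Suc n)) \<theta> * ?s =
      \<theta> * (ball_sum (k + Suc n) \<theta> * ?s) - q * (ball_sum (k + n) \<theta> * ?s)"
    by (simp add: ball_sum_rec algebra_simps)
  also have "\<dots> = \<theta> * (?b * (sqrt q ^ Suc n * sin (real (Suc n) * \<phi>))) -
      sqrt q * sqrt q * (?b * (sqrt q ^ n * sin (real n * \<phi>)))"
    unfolding ge2 sq(2) ..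
  also have "\<theta> * (?b * (sqrt q ^ Suc n * sin (real (Suc n) * \<phi>))) =
      2 * sqrt q * cos \<phi> * (?b * (sqrt q ^ Suc n * sin (real (Suc n) * \<phi>)))"
    using th by simp
  also have "\<dots> - sqrt q * sqrt q * (?b * (sqrt q ^ n * sin (real n * \<phi>))) = ?b * (sqrt q ^ Suc (Suc n) *
      (2 * cos \<phi> * sin (real (Suc n) * \<phi>) - sin (real n * \<phi>)))"
    unfolding power_Suc by algebra
  finally show ?case unfolding trig .
qed

text \<open>Squaring turns the amplitude into a multiple of q^n, which the volume of the ball of
  radius k + n dominates. The constant is uniform in \<open>n\<close>, so only the sine has to be
  made small.\<close>

lemma ball_sum_square_bound:
  assumes \<theta>: "\<bar>\<theta>\<bar> < 2 * sqrt q" and zero: "ball_sum k \<theta> = 0"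
  defines "\<phi> \<equiv> arccos (\<theta> / (2 * sqrt q))"
  shows "\<exists>c\<ge>0. \<forall>n x. (ball_sum (k + n) \<theta>)\<^sup>2 / card (graph_ball T x (k + n)) \<le> c * (sin (real n * \<phi>))\<^sup>2"
proof -
  have sq: "sqrt q > 0" using q2 by auto
  have "-1 < \<theta> / (2 * sqrt q)" "\<theta> / (2 * sqrt q) < 1" using \<theta> sq by (auto simp: field_simps abs_less_iff)
  then have "0 < \<phi>" "\<phi> < pi" unfolding \<phi>_def using arccos_lt_bounded by auto
  then have s: "sin \<phi> * sqrt q \<noteq> 0" using sq sin_gt_zero[of \<phi>] by simp
  define c where "c = (ball_sum (Suc k) \<theta> / (sin \<phi> * sqrt q))\<^sup>2"
  have "(ball_sum (k + n) \<theta>)\<^sup>2 / card (graph_ball T x (k + n)) \<le> c * (sin (real n * \<phi>))\<^sup>2" for n x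
  proof -
    have "ball_sum (k + n) \<theta> = ball_sum (Suc k) \<theta> / (sin \<phi> * sqrt q) * (sqrt q ^ n * sin (real n * \<phi>))"
      using ball_sum_oscillates[OF \<theta> zero, of n] s unfolding \<phi>_def[symmetric]
      by (metis nonzero_mult_div_cancel_right times_divide_eq_left)
    then have "(ball_sum (k + n) \<theta>)\<^sup>2 = c * (sqrt q ^ n * sin (real n * \<phi>))\<^sup>2"
      by (simp add: c_def power_mult_distrib power_divide)
    also have "(sqrt q ^ n * sin (real n * \<phi>))\<^sup>2 = real q ^ n * (sin (real n * \<phi>))\<^sup>2"
      by (simp add: power_mult_distrib flip: power_mult) (simp add: power_mult mult.commute[of n 2])
    also have "c * (real q ^ n * (sin (real n * \<phi>))\<^sup>2) = (c * (sin (real n * \<phi>))\<^sup>2) * real q ^ n" by simp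
    also have "\<dots> \<le> (c * (sin (real n * \<phi>))\<^sup>2) * card (graph_ball T x (k + n))"
    proof (rule mult_left_mono)
      have "real q ^ n \<le> real q ^ (k + n)" using q2 by (intro power_increasing) auto
      then show "real q ^ n \<le> card (graph_ball T x (k + n))" using card_ball_lower[of "k + n" x] by linarith
    qed (simp add: c_def)
    finally show ?thesis using card_ball_pos[of x "k + n"] by (simp add: pos_divide_le_eq)
  qed
  moreover have "c \<ge> 0" by (simp add: c_def)
  ultimately show ?thesis by blast
qed

lemma liminf_zero:
  assumes fin: "finite A" and \<theta>: "\<And>\<theta>. \<theta> \<in> A \<Longrightarrow> \<bar>\<theta>\<bar> < 2 * sqrt q" "\<And>\<theta>. \<theta> \<in> A \<Longrightarrow> ball_sum k \<theta> = 0"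
    and w: "\<And>\<theta>. 0 \<le> w \<theta>"
  shows "liminf (\<lambda>r. ereal ((\<Sum>\<theta>\<in>A. w \<theta> * (ball_sum r \<theta>)\<^sup>2) / card (graph_ball T x r))) = 0"
    (is "liminf (\<lambda>r. ereal (?X r)) = 0")
proof (rule antisym)
  have X0: "0 \<le> ?X r" for r using w by (intro divide_nonneg_nonneg sum_nonneg) auto
  show "0 \<le> liminf (\<lambda>r. ereal (?X r))" by (rule Liminf_bounded) (use X0 in simp)
  define \<phi> where "\<phi> \<theta> = arccos (\<theta> / (2 * sqrt q))" for \<theta> :: real
  have "\<forall>\<theta>\<in>A. \<exists>c\<ge>0. \<forall>n x. (ball_sum (k + n) \<theta>)\<^sup>2 / card (graph_ball T x (k + n)) \<le> c * (sin (real n * \<phi> \<theta>))\<^sup>2"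
    unfolding \<phi>_def using ball_sum_square_bound \<theta> by blast
  then obtain c where c: "\<And>\<theta>. \<theta> \<in> A \<Longrightarrow> c \<theta> \<ge> 0" "\<And>\<theta> n x. \<theta> \<in> A \<Longrightarrow>
      (ball_sum (k + n) \<theta>)\<^sup>2 / card (graph_ball T x (k + n)) \<le> c \<theta> * (sin (real n * \<phi> \<theta>))\<^sup>2"
    by metis
  define K where "K = (\<Sum>\<theta>\<in>A. w \<theta> * c \<theta>)"
  have "K \<ge> 0" unfolding K_def using w c(1) by (simp add: sum_nonneg)
  have bound: "?X (k + n) \<le> K * \<epsilon>\<^sup>2" if "\<forall>\<theta>\<in>A. \<bar>sin (real n * \<phi> \<theta>)\<bar> < \<epsilon>" for n \<epsilon>
  proof -
    have "?X (k + n) = (\<Sum>\<theta>\<in>A. w \<theta> * ((ball_sum (k + n) \<theta>)\<^sup>2 / card (graph_ball T x (k + n))))"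
      by (simp add: sum_divide_distrib)
    also have "\<dots> \<le> (\<Sum>\<theta>\<in>A. w \<theta> * (c \<theta> * \<epsilon>\<^sup>2))"
    proof (intro sum_mono mult_left_mono w)
      fix \<theta> assume "\<theta> \<in> A"
      have "(sin (real n * \<phi> \<theta>))\<^sup>2 \<le> \<epsilon>\<^sup>2"
        using that \<open>\<theta> \<in> A\<close> by (metis abs_ge_zero less_imp_le power2_abs power_mono)
      then show "(ball_sum (k + n) \<theta>)\<^sup>2 / card (graph_ball T x (k + n)) \<le> c \<theta> * \<epsilon>\<^sup>2"
        using c[OF \<open>\<theta> \<in> A\<close>] by (meson mult_left_mono order_trans)
    qed
    also have "\<dots> = K * \<epsilon>\<^sup>2" by (simp add: K_def sum_distrib_right mult.assoc)
    finally show ?thesis .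
  qed
  show "liminf (\<lambda>r. ereal (?X r)) \<le> 0"
  proof (rule ccontr)
    assume "\<not> liminf (\<lambda>r. ereal (?X r)) \<le> 0"
    then have "0 < liminf (\<lambda>r. ereal (?X r))" by (simp only: not_le)
    from ereal_dense2[OF this] obtain b where "0 < ereal b" and b': "ereal b < liminf (\<lambda>r. ereal (?X r))"
      by blast
    then have b: "0 < b" by simp
    from b' have "eventually (\<lambda>r. ereal b < ereal (?X r)) sequentially" by (intro less_LiminfD)
    then obtain N where N: "\<And>r. r \<ge> N \<Longrightarrow> b < ?X r" by (auto simp: eventually_sequentially)
    \<comment> \<open>Makes K times the square of \<epsilon> at most b; adding 1 keeps the
      denominator positive when K = 0.\<close>
    define \<epsilon> where "\<epsilon> = sqrt (b / (K + 1))"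
    have "\<epsilon> > 0" using b \<open>K \<ge> 0\<close> by (simp add: \<epsilon>_def)
    then obtain n where n: "n \<ge> N" "\<forall>\<theta>\<in>A. \<bar>sin (real n * \<phi> \<theta>)\<bar> < \<epsilon>"
      using sin_multiples_small[OF fin] by blast
    have "?X (k + n) \<le> K * (b / (K + 1))" using bound[OF n(2)] b \<open>K \<ge> 0\<close> by (simp add: \<epsilon>_def)
    also have "\<dots> \<le> b" using b \<open>K \<ge> 0\<close> by (simp add: field_simps)
    finally show False using N[of "k + n"] n(1) by simp
  qed
qed

text \<open>At \<theta> = 0 the recurrence multiplies by -q every two steps, starting from 1 and 1.
  The square is q^r for even r and q^(r - 1) for odd r; the factor q on the right covers both
  parities.\<close>

lemma ball_sum_zero_eigenvalue: "real q ^ r \<le> q * (ball_sum r 0)\<^sup>2"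
proof (induction r rule: induct_nat_012)
  case (ge2 r)
  have "real q ^ Suc (Suc r) \<le> (real q)\<^sup>2 * (q * (ball_sum r 0)\<^sup>2)"
    using mult_left_mono[OF ge2(1), of "(real q)\<^sup>2"] by (simp add: power2_eq_square mult.assoc)
  then show ?case by (simp add: ball_sum_rec power_mult_distrib mult_ac)
qed (use q2 in \<open>auto simp: ball_sum_0 ball_sum_1\<close>)

lemma liminf_pos:
  assumes "finite A" "0 \<in> A" and w: "\<And>\<theta>. 0 \<le> w \<theta>" "0 < w 0"
  shows "0 < liminf (\<lambda>r. ereal ((\<Sum>\<theta>\<in>A. w \<theta> * (ball_sum r \<theta>)\<^sup>2) / card (graph_ball T x r)))"
proof -
  \<comment> \<open>The 3 comes from \<open>card_ball_upper\<close> and the q from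
    \<open>ball_sum_zero_eigenvalue\<close>; the other eigenvalues contribute nonnegative
    terms.\<close>
  have "w 0 / (3 * q) \<le> (\<Sum>\<theta>\<in>A. w \<theta> * (ball_sum r \<theta>)\<^sup>2) / card (graph_ball T x r)" for r
  proof -
    have "w 0 * card (graph_ball T x r) \<le> w 0 * (3 * (q * (ball_sum r 0)\<^sup>2))"
      using card_ball_upper[of x r] ball_sum_zero_eigenvalue[of r] w(2) by (intro mult_left_mono) auto
    also have "\<dots> \<le> 3 * q * (\<Sum>\<theta>\<in>A. w \<theta> * (ball_sum r \<theta>)\<^sup>2)"
      using member_le_sum[OF assms(2) _ assms(1), of "\<lambda>\<theta>. w \<theta> * (ball_sum r \<theta>)\<^sup>2"] w(1) q2
      by (simp add: mult_ac mult_left_mono)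
    finally show ?thesis using card_ball_pos[of x r] q2 by (simp add: field_simps)
  qed
  then have "ereal (w 0 / (3 * q)) \<le> liminf (\<lambda>r. ereal ((\<Sum>\<theta>\<in>A. w \<theta> * (ball_sum r \<theta>)\<^sup>2) / card (graph_ball T x r)))"
    by (intro Liminf_bounded always_eventually allI) simp
  moreover have "0 < ereal (w 0 / (3 * q))" using w(2) q2 by simp
  ultimately show ?thesis by (rule less_le_trans[rotated])
qed

end

subsection \<open>The three graphs\<close>

context tree
begin

lemma sub_osc_liminf_zero:
  assumes orbit: "spectral_orbit q T V E \<pi> m x S e"
    and zero: "\<And>\<theta>. \<theta> \<in> S \<Longrightarrow> \<bar>\<theta>\<bar> < 2 * sqrt q \<Longrightarrow> ball_sum k \<theta> = 0"
  shows "liminf (\<lambda>r. ereal (sub_osc_number_variance q T x (random_lattice_orbit T x m) r /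
           real (card (graph_ball T x r)))) = 0"
proof -
  interpret spectral_orbit q T V E \<pi> m x S e by (rule orbit)
  show ?thesis
    unfolding sub_osc_number_variance_eq ball_sum_def[symmetric]
    by (rule liminf_zero[where k = k]) (use finite_S zero weight_nonneg in auto)
qed

lemma sub_osc_liminf_pos:
  assumes orbit: "spectral_orbit q T V E \<pi> m x S e" and "0 \<in> S" "v \<in> V" "e 0 v \<noteq> 0"
  shows "0 < liminf (\<lambda>r. ereal (sub_osc_number_variance q T x (random_lattice_orbit T x m) r /
           real (card (graph_ball T x r))))"
proof -
  interpret spectral_orbit q T V E \<pi> m x S e by (rule orbit)
  have "0 < (\<Sum>w\<in>V. (e 0 w)\<^sup>2)"
    using finite_V assms(3,4) by (intro sum_pos2[of V v]) auto
  moreover have "card V > 0" using finite_V assms(3) card_gt_0_iff by blast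
  ultimately have "0 < weight 0" unfolding weight_def by simp
  then show ?thesis
    unfolding sub_osc_number_variance_eq ball_sum_def[symmetric]
    using finite_S assms(2) weight_nonneg q2 by (intro liminf_pos) auto
qed

text \<open>On the complete graph the adjacency operator is summation over all vertices minus the
  identity, so a function with sum zero has eigenvalue -1. The indicator splits into its mean and
  the remainder.\<close>

lemma complete_spectral_orbit:
  assumes "covering_map T (complete_verts (q + 2)) (complete_adj (q + 2)) \<pi>"
    and "invariant_coset_probability T (deck_group T \<pi>) m"
  shows "spectral_orbit q T (complete_verts (q + 2)) (complete_adj (q + 2)) \<pi> m x {real q + 1, -1}
     (\<lambda>\<theta> v. if \<theta> = -1 then of_bool (v = \<pi> x) - 1 / (real q + 2) else 1 / (real q + 2))"
proof unfold_locales
  have u: "\<pi> x \<in> complete_verts (q + 2)" using assms(1) by (auto simp: covering_map_def)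
  fix \<theta> v assume \<theta>: "\<theta> \<in> {real q + 1, -1}" and v: "v \<in> complete_verts (q + 2)"
  have nbrs: "{w. complete_adj (q + 2) v w} = complete_verts (q + 2) - {v}"
    using v by (auto simp: complete_adj_def)
  define V where "V = complete_verts (q + 2)"
  have fin: "finite V" and "card V = q + 2" by (simp_all add: V_def complete_verts_def)
  then have card: "real (card (V - {v})) = real q + 1" using v by (simp add: V_def)
  have delta: "(\<Sum>w\<in>V - {v}. of_bool (w = \<pi> x)) = (1::real) - of_bool (v = \<pi> x)"
    using u v fin by (simp add: sum_diff1 of_bool_def V_def)
  have shift: "(\<Sum>w\<in>V - {v}. of_bool (w = \<pi> x) - 1 / (real q + 2)) =
      1 - of_bool (v = \<pi> x) - (real q + 1) * (1 / (real q + 2))"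
    by (simp only: sum_subtractf sum_constant card delta)
  have const: "(\<Sum>w\<in>V - {v}. 1 / (real q + 2)) = (real q + 1) * (1 / (real q + 2))"
    by (simp only: sum_constant card)
  have split: "1 - b - (real q + 1) * (1 / (real q + 2)) = - 1 * (b - 1 / (real q + 2))" for b :: real
    by (simp add: field_simps)
  show "(\<Sum>w | complete_adj (q + 2) v w. if \<theta> = -1 then of_bool (w = \<pi> x) - 1 / (real q + 2) else 1 / (real q + 2)) =
      \<theta> * (if \<theta> = -1 then of_bool (v = \<pi> x) - 1 / (real q + 2) else 1 / (real q + 2))"
  proof (cases "\<theta> = -1")
    case True
    show ?thesis unfolding nbrs V_def[symmetric] True simp_thms if_True shift by (rule split)
  next
    case False
    then have "\<theta> = real q + 1" using \<theta> by blast
    then show ?thesis unfolding nbrs V_def[symmetric] using False by (simp only: if_False const)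
  qed
next
  have "sqrt (real q) \<ge> 1" using q2 by simp
  then have "2 * sqrt (real q) > 1" by linarith
  then show "\<theta> = real q + 1 \<or> \<theta> = - (real q + 1) \<or> \<bar>\<theta>\<bar> < 2 * sqrt (real q)"
    if "\<theta> \<in> {real q + 1, -1}" for \<theta> using that by auto
qed (use assms in \<open>auto simp: complete_adj_def complete_verts_def\<close>)

lemma bipartite_nbrs:
  assumes "v \<in> bipartite_verts n"
  shows "(\<Sum>w | bipartite_adj n v w. f w) = (if isl v then \<Sum>i<n. f (Inr i) else \<Sum>i<n. f (Inl i))"
proof -
  have "{w. bipartite_adj n v w} = (if isl v then Inr ` {..<n} else Inl ` {..<n})"
    using assms by (auto simp: bipartite_adj_def bipartite_verts_def)
  then show ?thesis by (simp add: sum.reindex)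
qed

text \<open>A function with sum zero on each side is annihilated by the adjacency operator; the
  indicator minus its mean over its own side is of this kind. That mean splits evenly into a
  constant (eigenvalue k) and a function changing sign between the sides (eigenvalue -k).\<close>

lemma bipartite_spectral_orbit:
  assumes "covering_map T (bipartite_verts (q + 1)) (bipartite_adj (q + 1)) \<pi>"
    and "invariant_coset_probability T (deck_group T \<pi>) m"
  defines "k \<equiv> real q + 1"
  shows "spectral_orbit q T (bipartite_verts (q + 1)) (bipartite_adj (q + 1)) \<pi> m x {k, 0, - k}
     (\<lambda>\<theta> v. if \<theta> = 0 then of_bool (v = \<pi> x) - (if isl v = isl (\<pi> x) then 1 / k else 0)
            else if \<theta> = k \<or> isl v = isl (\<pi> x) then 1 / (2 * k) else - 1 / (2 * k))"
proof unfold_locales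
  have k: "k > 0" by (simp add: k_def)
  have u: "\<pi> x \<in> bipartite_verts (q + 1)" using assms(1) by (auto simp: covering_map_def)
  fix \<theta> v assume \<theta>: "\<theta> \<in> {k, 0, - k}" and v: "v \<in> bipartite_verts (q + 1)"
  have c: "(\<Sum>i<Suc q. c) = k * c" for c by (simp add: k_def)
  have s: "(\<Sum>i<Suc q. of_bool (i = j)) = (1::real)" if "j < Suc q" for j
    using that by (simp add: of_bool_def)
  show "(\<Sum>w | bipartite_adj (q + 1) v w. if \<theta> = 0 then of_bool (w = \<pi> x) - (if isl w = isl (\<pi> x) then 1 / k else 0)
            else if \<theta> = k \<or> isl w = isl (\<pi> x) then 1 / (2 * k) else - 1 / (2 * k)) =
      \<theta> * (if \<theta> = 0 then of_bool (v = \<pi> x) - (if isl v = isl (\<pi> x) then 1 / k else 0)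
            else if \<theta> = k \<or> isl v = isl (\<pi> x) then 1 / (2 * k) else - 1 / (2 * k))"
  proof (cases "\<pi> x")
    case (Inl j)
    then have "j < q + 1" using u by (auto simp: bipartite_verts_def)
    then show ?thesis unfolding bipartite_nbrs[OF v] using \<theta> k s[of j] Inl
      by (auto simp: sum_subtractf c simp del: sum_constant lessThan_Suc sum.lessThan_Suc)
  next
    case (Inr j)
    then have "j < q + 1" using u by (auto simp: bipartite_verts_def)
    then show ?thesis unfolding bipartite_nbrs[OF v] using \<theta> k s[of j] Inr
      by (auto simp: sum_subtractf c simp del: sum_constant lessThan_Suc sum.lessThan_Suc)
  qed
next
  fix v
  have k: "k > 0" by (simp add: k_def)
  then have d: "k \<noteq> 0" "k \<noteq> - k" by auto
  show "(\<Sum>\<theta>\<in>{k, 0, - k}. if \<theta> = 0 then of_bool (v = \<pi> x) - (if isl v = isl (\<pi> x) then 1 / k else 0)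
            else if \<theta> = k \<or> isl v = isl (\<pi> x) then 1 / (2 * k) else - 1 / (2 * k)) = of_bool (v = \<pi> x)"
    using d k by (auto simp: field_simps)
next
  show "\<theta> = real q + 1 \<or> \<theta> = - (real q + 1) \<or> \<bar>\<theta>\<bar> < 2 * sqrt (real q)" if "\<theta> \<in> {k, 0, - k}" for \<theta>
    using that q2 by (auto simp: k_def)
qed (use assms in \<open>auto simp: bipartite_adj_def bipartite_verts_def\<close>)

end

lemma petersen_verts_eq:
  "petersen_verts = {{0,1}, {0,2}, {0,3}, {0,4}, {1,2}, {1,3}, {1,4}, {2,3}, {2,4}, {3,4}}"
proof (intro equalityI subsetI)
  fix A assume "A \<in> petersen_verts"
  then obtain i j where A: "A = {i, j}" "i \<noteq> j" "i < 5" "j < 5"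
    by (auto simp: petersen_verts_def card_2_iff)
  have "i \<in> {0,1,2,3,4}" "j \<in> {0,1,2,3,4}" using A by auto
  then show "A \<in> {{0,1}, {0,2}, {0,3}, {0,4}, {1,2}, {1,3}, {1,4}, {2,3}, {2,4}, {3,4}}"
    using A(1,2) by (elim insertE emptyE) (simp_all add: insert_commute)
qed (auto simp: petersen_verts_def)

lemma petersen_nbrs:
  "{w. petersen_adj {0,1} w} = {{2,3}, {2,4}, {3,4}}"
  "{w. petersen_adj {0,2} w} = {{1,3}, {1,4}, {3,4}}"
  "{w. petersen_adj {0,3} w} = {{1,2}, {1,4}, {2,4}}"
  "{w. petersen_adj {0,4} w} = {{1,2}, {1,3}, {2,3}}"
  "{w. petersen_adj {1,2} w} = {{0,3}, {0,4}, {3,4}}"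
  "{w. petersen_adj {1,3} w} = {{0,2}, {0,4}, {2,4}}"
  "{w. petersen_adj {1,4} w} = {{0,2}, {0,3}, {2,3}}"
  "{w. petersen_adj {2,3} w} = {{0,1}, {0,4}, {1,4}}"
  "{w. petersen_adj {2,4} w} = {{0,1}, {0,3}, {1,3}}"
  "{w. petersen_adj {3,4} w} = {{0,1}, {0,2}, {1,2}}"
  unfolding petersen_adj_def petersen_verts_eq by (auto simp: doubleton_eq_iff)

text \<open>
  The projections of the indicator of \<open>u\<close> to the eigenspaces of \<open>3\<close>, \<open>1\<close>, \<open>-2\<close>, of dimensions 1, 5, 4.
\<close>

definition petersen_eigen :: "nat set \<Rightarrow> real \<Rightarrow> nat set \<Rightarrow> real" where
  "petersen_eigen u \<theta> v =
    (if \<theta> = 3 then 1/10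
     else if \<theta> = 1 then (if v = u then 1/2 else if v \<inter> u = {} then 1/6 else -1/6)
     else (if v = u then 2/5 else if v \<inter> u = {} then -4/15 else 1/15))"

text \<open>Origin of the values: at \<open>u\<close> the dimension of the eigenspace over 10; at a
  neighbour \<theta>/3 times that, by the equation at \<open>u\<close>; at distance two what the
  equation at a neighbour leaves. The proof checks every pair of vertices.\<close>

lemma petersen_eigen:
  assumes "u \<in> petersen_verts" "v \<in> petersen_verts" "\<theta> \<in> {3, 1, -2}"
  shows "(\<Sum>w | petersen_adj v w. petersen_eigen u \<theta> w) = \<theta> * petersen_eigen u \<theta> v"
  using assms unfolding petersen_verts_eq
  by (elim insertE emptyE; hypsubst; simp only: petersen_nbrs; simp add: petersen_eigen_def doubleton_eq_iff)

lemma (in tree) petersen_spectral_orbit: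
  assumes "q = 2" "covering_map T petersen_verts petersen_adj \<pi>"
    and "invariant_coset_probability T (deck_group T \<pi>) m"
  shows "spectral_orbit q T petersen_verts petersen_adj \<pi> m x {3, 1, -2} (petersen_eigen (\<pi> x))"
proof unfold_locales
  have u: "\<pi> x \<in> petersen_verts" using assms(2) by (auto simp: covering_map_def)
  show "(\<Sum>w | petersen_adj v w. petersen_eigen (\<pi> x) \<theta> w) = \<theta> * petersen_eigen (\<pi> x) \<theta> v"
    if "\<theta> \<in> {3, 1, -2}" "v \<in> petersen_verts" for \<theta> v
    by (rule petersen_eigen) fact+
  have "2 < 2 * sqrt (real q)" using assms(1) real_less_rsqrt[of 1 2] by simp
  then have "\<bar>1\<bar> < 2 * sqrt (real q)" "\<bar>-2\<bar> < 2 * sqrt (real q)" by linarith+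
  moreover have "3 = real q + 1" using assms(1) by simp
  ultimately show "\<theta> = real q + 1 \<or> \<theta> = - (real q + 1) \<or> \<bar>\<theta>\<bar> < 2 * sqrt (real q)" if "\<theta> \<in> {3, 1, -2}" for \<theta>
    using that by blast
next
  show "finite petersen_verts" by (simp add: petersen_verts_eq)
  show "petersen_adj w v" if "petersen_adj v w" for v w
    using that by (simp add: petersen_adj_def Int_commute)
  show "(\<Sum>\<theta>\<in>{3, 1, -2}. petersen_eigen (\<pi> x) \<theta> v) = of_bool (v = \<pi> x)" for v
    by (simp add: petersen_eigen_def)
qed (use assms in simp_all)

theorem theorem1p5:
  fixes q :: nat and T :: "'v \<Rightarrow> 'v \<Rightarrow> bool" and x\<^sub>0 :: 'v
  assumes "q \<ge> 2" and "regular_tree (q + 1) T"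
  shows
    "(\<forall>\<pi> m. covering_map T (complete_verts (q + 2)) (complete_adj (q + 2)) \<pi> \<and>
        invariant_coset_probability T (deck_group T \<pi>) m \<longrightarrow>
        liminf (\<lambda>r. ereal (sub_osc_number_variance q T x\<^sub>0 (random_lattice_orbit T x\<^sub>0 m) r /
                           real (card (graph_ball T x\<^sub>0 r)))) = 0) \<and>
     (\<forall>\<pi> m. covering_map T (bipartite_verts (q + 1)) (bipartite_adj (q + 1)) \<pi> \<and>
        invariant_coset_probability T (deck_group T \<pi>) m \<longrightarrow>
        liminf (\<lambda>r. ereal (sub_osc_number_variance q T x\<^sub>0 (random_lattice_orbit T x\<^sub>0 m) r /
                           real (card (graph_ball T x\<^sub>0 r)))) > 0) \<and>
     (q = 2 \<longrightarrow>
       (\<forall>\<pi> m. covering_map T petersen_verts petersen_adj \<pi> \<and>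
          invariant_coset_probability T (deck_group T \<pi>) m \<longrightarrow>
          liminf (\<lambda>r. ereal (sub_osc_number_variance q T x\<^sub>0 (random_lattice_orbit T x\<^sub>0 m) r /
                             real (card (graph_ball T x\<^sub>0 r)))) = 0))"
proof -
  interpret tree q T by standard (rule assms)+
  have 1: "liminf (\<lambda>r. ereal (sub_osc_number_variance q T x\<^sub>0 (random_lattice_orbit T x\<^sub>0 m) r /
      real (card (graph_ball T x\<^sub>0 r)))) = 0"
    if "covering_map T (complete_verts (q + 2)) (complete_adj (q + 2)) \<pi>"
      "invariant_coset_probability T (deck_group T \<pi>) m" for \<pi> m
  proof (rule sub_osc_liminf_zero[OF complete_spectral_orbit[OF that], where k = 1])
    fix \<theta> assume "\<theta> \<in> {real q + 1, -1}" "\<bar>\<theta>\<bar> < 2 * sqrt (real q)"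
    then have "\<theta> = -1" using two_sqrt_less by auto
    then show "ball_sum 1 \<theta> = 0" by (simp add: ball_sum_1)
  qed
  have 2: "liminf (\<lambda>r. ereal (sub_osc_number_variance q T x\<^sub>0 (random_lattice_orbit T x\<^sub>0 m) r /
      real (card (graph_ball T x\<^sub>0 r)))) > 0"
    if cov: "covering_map T (bipartite_verts (q + 1)) (bipartite_adj (q + 1)) \<pi>"
      and inv: "invariant_coset_probability T (deck_group T \<pi>) m" for \<pi> m
  \<comment> \<open>At the base vertex the component for eigenvalue 0 equals 1 - 1 / (q + 1), which
    is nonzero.\<close>
  proof (rule sub_osc_liminf_pos[OF bipartite_spectral_orbit[OF that], where v = "\<pi> x\<^sub>0"])
    show "\<pi> x\<^sub>0 \<in> bipartite_verts (q + 1)" using cov by (auto simp: covering_map_def)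
  qed (use q2 in auto)
  have 3: "liminf (\<lambda>r. ereal (sub_osc_number_variance q T x\<^sub>0 (random_lattice_orbit T x\<^sub>0 m) r /
      real (card (graph_ball T x\<^sub>0 r)))) = 0"
    if "q = 2" "covering_map T petersen_verts petersen_adj \<pi>"
      "invariant_coset_probability T (deck_group T \<pi>) m" for \<pi> m
  proof (rule sub_osc_liminf_zero[OF petersen_spectral_orbit[OF that], where k = 2])
    fix \<theta> :: real assume \<theta>: "\<theta> \<in> {3, 1, -2}" "\<bar>\<theta>\<bar> < 2 * sqrt (real q)"
    then have "\<theta> = 1 \<or> \<theta> = -2" using two_sqrt_less \<open>q = 2\<close> by auto
    \<comment> \<open>For q = 2 the left side factors as (\<theta> - 1) * (\<theta> + 2).\<close>
    then have "\<theta> * (1 + \<theta>) - real q = 0" using \<open>q = 2\<close> by auto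
    moreover have "ball_sum 2 \<theta> = \<theta> * (1 + \<theta>) - real q"
      using ball_sum_rec[of 0 \<theta>] by (simp add: ball_sum_0 ball_sum_1 numeral_2_eq_2)
    ultimately show "ball_sum 2 \<theta> = 0" by simp
  qed
  from 1 2 3 show ?thesis by blast
qed

end
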